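(* Let $m=p+q$ with $p,q\ge1$, write $\mathbb R^m=\mathbb R^p\oplus\mathbb R^q$, $x=u+v$ with $u\in\mathbb R^p$, $v\in\mathbb R^q$ (so $|x|^2=|u|^2+|v|^2$), and let $s,k,i\in\mathbb N$. Let $P_k(u)\in\mathcal H_k(\mathbb R^p)$ and $Q_i(v)\in\mathcal H_i(\mathbb R^q)$. Then $$P_H\big(|u|^{2s}P_k(u)Q_i(v)\big)=\lambda(s,k,i)\,|x|^{2s}\,P_s^{\,k+\frac{p-2}{2},\,i+\frac{q-2}{2}}\!\left(\frac{|v|^2-|u|^2}{|v|^2+|u|^2}\right)P_k(u)Q_i(v),$$ where $$\lambda(s,k,i)=(-1)^s\binom{2s+k+i+\frac m2-2}{s}^{-1}=\frac{(-1)^s\,s!}{\left(s+k+i+\frac{m-2}{2}\right)_s}.$$ The Fischer norm is given by $$\big\|P_H\big(|u|^{2s}P_k(u)Q_i(v)\big)\big\|_m^2=c(s,k,i,p,q)\,\|P_k(u)\|_p^2\,\|Q_i(v)\|_q^2,$$ where $$c(s,k,i,p,q):=4^s\,s!\,\frac{\left(k+\frac p2\right)_s\left(i+\frac q2\right)_s}{\left(s+k+i+\frac{m-2}{2}\right)_s}.$$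
   Context: $\mathbb N=\{0,1,2,\dots\}$. $\mathcal P(\mathbb R^d)$ is the space of complex-valued polynomials on $\mathbb R^d$, $\mathcal H(\mathbb R^d)$ its subspace of harmonic polynomials and $\mathcal H_k(\mathbb R^d)$ the space of harmonic polynomials homogeneous of degree $k$. $P_H:\mathcal P(\mathbb R^m)\to\mathcal H(\mathbb R^m)$ is the harmonic projection, i.e. the projection onto the $s=0$ summand of the (Fischer) decomposition $\mathcal P(\mathbb R^m)=\bigoplus_{s\ge0}|x|^{2s}\mathcal H(\mathbb R^m)$. $(a)_s=a(a+1)\cdots(a+s-1)$, $(a)_0=1$, is the Pochhammer symbol, and $\binom{a}{s}=\frac{a(a-1)\cdots(a-s+1)}{s!}$ for real $a$. $P_s^{\alpha,\beta}$ is the classical Jacobi polynomial, $$P_s^{\alpha,\beta}(t)=\frac1{2^s}\sum_{j=0}^s\binom{\alpha+s}{j}\binom{\beta+s}{s-j}(t+1)^j(t-1)^{s-j};$$ hence $|x|^{2s}P_s^{\alpha,\beta}\big(\frac{|v|^2-|u|^2}{|v|^2+|u|^2}\big)$ is a polynomial in $|u|^2,|v|^2$. The Fischer inner product on $\mathcal P(\mathbb R^d)$ is $\langle P,Q\rangle_d=\overline P(\partial_{x})Q(x)|_{x=0}$, where $\overline P$ is $P$ with complex conjugated coefficients and each variable $x_j$ is replaced by $\partial_{x_j}$; $\|P\|_d^2=\langle P,P\rangle_d$. *)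

theory Defs
  imports "HOL-Analysis.Analysis"
begin

(* R^d is a Euclidean space with its coordinate basis Basis. Complex polynomials on it are
   functions f :: 'a => complex with polynomial_function f. *)

definition partial :: "'a::euclidean_space \<Rightarrow> ('a \<Rightarrow> complex) \<Rightarrow> 'a \<Rightarrow> complex" where
  "partial b f = (\<lambda>x. frechet_derivative f (at x) b)"

definition laplacian :: "('a::euclidean_space \<Rightarrow> complex) \<Rightarrow> 'a \<Rightarrow> complex" where
  "laplacian f = (\<lambda>x. \<Sum>b\<in>Basis. partial b (partial b f) x)"

definition harmonic_polys :: "('a::euclidean_space \<Rightarrow> complex) set" where
  "harmonic_polys = {f. polynomial_function f \<and> (\<forall>x. laplacian f x = 0)}"

definition homogeneous :: "nat \<Rightarrow> ('a::euclidean_space \<Rightarrow> complex) \<Rightarrow> bool" where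
  "homogeneous k f \<longleftrightarrow> (\<forall>(t::real) x. f (t *\<^sub>R x) = of_real t ^ k * f x)"

definition harmonic_polys_deg :: "nat \<Rightarrow> ('a::euclidean_space \<Rightarrow> complex) set" where
  "harmonic_polys_deg k = {f \<in> harmonic_polys. homogeneous k f}"

(* H s is the harmonic factor of the summand |x|^(2s) H s. *)
definition fischer_decomposition ::
    "('a::euclidean_space \<Rightarrow> complex) \<Rightarrow> (nat \<Rightarrow> 'a \<Rightarrow> complex) \<Rightarrow> bool" where
  "fischer_decomposition f H \<longleftrightarrow>
     (\<forall>s. H s \<in> harmonic_polys) \<and> finite {s. H s \<noteq> (\<lambda>x. 0)} \<and>
     (\<forall>x. f x = (\<Sum>s | H s \<noteq> (\<lambda>x. 0). of_real (norm x ^ (2 * s)) * H s x))"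

definition harmonic_proj :: "('a::euclidean_space \<Rightarrow> complex) \<Rightarrow> 'a \<Rightarrow> complex" where
  "harmonic_proj f = (THE H. fischer_decomposition f H) 0"

(* Multi-indices are functions on the basis, extended by 0 elsewhere to make them unique. *)
definition multi_indices :: "('a::euclidean_space \<Rightarrow> nat) set" where
  "multi_indices = {\<alpha>. \<forall>b. b \<notin> Basis \<longrightarrow> \<alpha> b = 0}"

definition monomial :: "('a::euclidean_space \<Rightarrow> nat) \<Rightarrow> 'a \<Rightarrow> complex" where
  "monomial \<alpha> x = of_real (\<Prod>b\<in>Basis. (x \<bullet> b) ^ \<alpha> b)"

definition poly_coeffs ::
    "('a::euclidean_space \<Rightarrow> complex) \<Rightarrow> ('a \<Rightarrow> nat) \<Rightarrow> complex" where
  "poly_coeffs f = (THE c. finite {\<alpha>. c \<alpha> \<noteq> 0} \<and> {\<alpha>. c \<alpha> \<noteq> 0} \<subseteq> multi_indices \<and>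
     (\<forall>x. f x = (\<Sum>\<alpha> | c \<alpha> \<noteq> 0. c \<alpha> * monomial \<alpha> x)))"

(* The enumeration fixes an order of differentiation, which is immaterial on polynomials. *)
definition multi_partial ::
    "('a::euclidean_space \<Rightarrow> nat) \<Rightarrow> ('a \<Rightarrow> complex) \<Rightarrow> 'a \<Rightarrow> complex" where
  "multi_partial \<alpha> f =
     foldr (\<lambda>b. partial b ^^ \<alpha> b) (SOME bs. distinct bs \<and> set bs = Basis) f"

definition fischer_inner ::
    "('a::euclidean_space \<Rightarrow> complex) \<Rightarrow> ('a \<Rightarrow> complex) \<Rightarrow> complex" where
  "fischer_inner P Q =
     (\<Sum>\<alpha> | poly_coeffs P \<alpha> \<noteq> 0. cnj (poly_coeffs P \<alpha>) * multi_partial \<alpha> Q 0)"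

(* Complex-valued, so that an equation between squared norms also covers imaginary parts. *)
definition fischer_norm_sq :: "('a::euclidean_space \<Rightarrow> complex) \<Rightarrow> complex" where
  "fischer_norm_sq P = fischer_inner P P"

definition jacobi :: "nat \<Rightarrow> real \<Rightarrow> real \<Rightarrow> real \<Rightarrow> real" where
  "jacobi s \<alpha> \<beta> t = 1 / 2 ^ s *
     (\<Sum>j\<le>s. ((\<alpha> + real s) gchoose j) * ((\<beta> + real s) gchoose (s - j)) *
       (t + 1) ^ j * (t - 1) ^ (s - j))"

definition proj_factor :: "nat \<Rightarrow> nat \<Rightarrow> nat \<Rightarrow> nat \<Rightarrow> real" where
  "proj_factor m s k i =
     (- 1) ^ s * inverse ((2 * real s + real k + real i + real m / 2 - 2) gchoose s)"

definition norm_factor :: "nat \<Rightarrow> nat \<Rightarrow> nat \<Rightarrow> nat \<Rightarrow> nat \<Rightarrow> real" where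
  "norm_factor s k i p q = 4 ^ s * fact s *
     (pochhammer (real k + real p / 2) s * pochhammer (real i + real q / 2) s /
      pochhammer (real s + real k + real i + (real (p + q) - 2) / 2) s)"

end

theory Submission
  imports Defs
begin

text \<open>Write \<open>R = |u|\<^sup>2\<close> and \<open>S = |v|\<^sup>2\<close>. The homogenised Jacobi polynomial
  \<open>J(R, S) = (R + S)\<^sup>s P\<^sub>s((S - R) / (S + R))\<close> makes \<open>J(R, S) P Q\<close> harmonic because its
  coefficients satisfy a two-term recursion. Since \<open>S\<close> is congruent to \<open>- R\<close> modulo
  \<open>R + S = |x|\<^sup>2\<close>, \<open>J(R, S)\<close> is congruent to \<open>J(1, -1) R\<^sup>s\<close>, where \<open>J(1, -1)\<close> is a single
  binomial coefficient by Vandermonde. Hence \<open>R\<^sup>s P Q\<close> is \<open>J(R, S) P Q / J(1, -1)\<close> plus a multiple of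
  \<open>|x|\<^sup>2\<close>, and the first term is the harmonic projection once the Fischer decomposition is unique.

  The Fischer product makes multiplication by \<open>|x|\<^sup>2\<close> adjoint to the Laplacian, so harmonic polynomials
  are orthogonal to multiples of \<open>|x|\<^sup>2\<close>; this gives uniqueness. It also shows that the squared norm of
  the projection is the product of \<open>R\<^sup>s P Q\<close> with \<open>J(R, S) P Q / J(1, -1)\<close>, to which only the
  \<open>R\<^sup>s\<close>-term of \<open>J\<close> contributes.\<close>

section \<open>Polynomials and their partial derivatives\<close>

text \<open>Polynomials as sums of monomial terms, so that identities additive in a polynomial
  reduce by induction to monomials. \<open>cpoly_iff\<close> identifies the class with
  \<open>polynomial_function\<close>.\<close>

inductive cpoly :: "('a::euclidean_space \<Rightarrow> complex) \<Rightarrow> bool" where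
  monom: "\<alpha> \<in> multi_indices \<Longrightarrow> cpoly (\<lambda>x. c * monomial \<alpha> x)"
| add: "cpoly f \<Longrightarrow> cpoly g \<Longrightarrow> cpoly (\<lambda>x. f x + g x)"

lemma monomial_add: "monomial (\<lambda>b. \<alpha> b + \<beta> b) x = monomial \<alpha> x * monomial \<beta> x"
  by (simp add: monomial_def power_add prod.distrib)

lemma monomial_zero [simp]: "monomial (\<lambda>b. 0) x = 1"
  by (simp add: monomial_def)

lemma monomial_unit:
  assumes "b \<in> Basis"
  shows "monomial (\<lambda>c. if c = b then 1 else 0) x = of_real (x \<bullet> b)"
proof -
  have "(\<Prod>c\<in>Basis. (x \<bullet> c) ^ (if c = b then 1 else 0)) = (\<Prod>c\<in>Basis. if c = b then x \<bullet> b else 1)"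
    by (rule prod.cong) auto
  then show ?thesis
    using assms by (simp add: monomial_def)
qed

lemma multi_indices_add: "\<alpha> \<in> multi_indices \<Longrightarrow> \<beta> \<in> multi_indices \<Longrightarrow> (\<lambda>b. \<alpha> b + \<beta> b) \<in> multi_indices"
  by (simp add: multi_indices_def)

lemma multi_indices_upd: "\<alpha> \<in> multi_indices \<Longrightarrow> b \<in> Basis \<Longrightarrow> \<alpha>(b := n) \<in> multi_indices"
  by (auto simp: multi_indices_def)

lemma multi_indices_zero [simp]: "(\<lambda>b. 0) \<in> multi_indices"
  by (simp add: multi_indices_def)

lemma cpoly_const: "cpoly (\<lambda>x. c)"
  using cpoly.monom[OF multi_indices_zero, of c] by simp

lemma cpoly_monomial: "\<alpha> \<in> multi_indices \<Longrightarrow> cpoly (monomial \<alpha>)"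
  using cpoly.monom[of \<alpha> 1] by simp

lemma cpoly_coordinate: "b \<in> Basis \<Longrightarrow> cpoly (\<lambda>x. of_real (x \<bullet> b))"
  using cpoly.monom[of "\<lambda>c. if c = b then 1 else 0" 1]
  by (auto simp: monomial_unit multi_indices_def simp del: of_real_inner_1)

lemma cpoly_cmult: "cpoly f \<Longrightarrow> cpoly (\<lambda>x. c * f x)"
proof (induction rule: cpoly.induct)
  case (monom \<alpha> d)
  then show ?case using cpoly.monom[of \<alpha> "c * d"] by (simp add: mult.assoc)
qed (auto simp: distrib_left intro: cpoly.add)

lemma cpoly_mult: "cpoly f \<Longrightarrow> cpoly g \<Longrightarrow> cpoly (\<lambda>x. f x * g x)"
proof (induction rule: cpoly.induct)
  case (monom \<alpha> c)
  from monom(2) show ?case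
  proof (induction rule: cpoly.induct)
    case (monom \<beta> d)
    have "cpoly (\<lambda>x. (c * d) * monomial (\<lambda>b. \<alpha> b + \<beta> b) x)"
      using monom \<open>\<alpha> \<in> multi_indices\<close> by (intro cpoly.monom multi_indices_add)
    then show ?case by (simp add: monomial_add mult_ac)
  qed (auto simp: distrib_left intro: cpoly.add)
qed (auto simp: distrib_right intro: cpoly.add)

lemma cpoly_sum: "(\<And>i. i \<in> I \<Longrightarrow> cpoly (f i)) \<Longrightarrow> cpoly (\<lambda>x. \<Sum>i\<in>I. f i x)"
  by (induction I rule: infinite_finite_induct) (auto intro: cpoly.add cpoly_const)

lemma cpoly_power: "cpoly f \<Longrightarrow> cpoly (\<lambda>x. f x ^ n)"
  by (induction n) (auto intro: cpoly_const cpoly_mult)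

lemmas cpoly_intros = cpoly_const cpoly_coordinate cpoly.add cpoly_mult cpoly_sum cpoly_power

lemma norm_sq_eq_sum: "(of_real (norm x ^ 2) :: complex) = (\<Sum>b\<in>Basis. of_real (x \<bullet> b) ^ 2)"
  unfolding power2_norm_eq_inner by (subst euclidean_inner) (simp add: power2_eq_square)

lemma cpoly_norm_sq: "cpoly (\<lambda>x. of_real (norm x ^ 2))"
  unfolding norm_sq_eq_sum by (intro cpoly_intros)

lemma cpoly_norm: "cpoly (\<lambda>x. of_real (norm x ^ (2 * n)))"
  unfolding power_mult of_real_power[of _ n] by (intro cpoly_power cpoly_norm_sq)

lemma cpoly_of_real:
  assumes "real_polynomial_function g"
  shows "cpoly (\<lambda>x::'a::euclidean_space. of_real (g x))"
  using assms
proof (induction rule: real_polynomial_function.induct)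
  case (linear f)
  then interpret bounded_linear f .
  have "of_real (f x) = (\<Sum>b\<in>Basis. of_real (x \<bullet> b) * of_real (f b) :: complex)" for x
  proof -
    have "f x = f (\<Sum>b\<in>Basis. (x \<bullet> b) *\<^sub>R b)"
      by (simp add: euclidean_representation)
    also have "\<dots> = (\<Sum>b\<in>Basis. (x \<bullet> b) * f b)"
      by (simp only: sum scaleR real_scaleR_def)
    finally show ?thesis by simp
  qed
  then have "(\<lambda>x. of_real (f x)) = (\<lambda>x. \<Sum>b\<in>Basis. of_real (x \<bullet> b) * of_real (f b) :: complex)"
    by (rule ext)
  then show ?case
    by (rule ssubst) (intro cpoly_sum cpoly_mult cpoly_coordinate cpoly_const)
qed (simp_all add: cpoly_const cpoly.add cpoly_mult)

lemma cpoly_iff: "cpoly f \<longleftrightarrow> polynomial_function f"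
proof
  assume "cpoly f"
  then show "polynomial_function f"
  proof (induction rule: cpoly.induct)
    case (monom \<alpha> c)
    have "real_polynomial_function (\<lambda>x. \<Prod>b\<in>Basis. (x \<bullet> b) ^ \<alpha> b)"
      by (intro real_polynomial_function_prod real_polynomial_function_power
          real_polynomial_function.intros(1) bounded_linear_inner_left) simp
    then have "polynomial_function (\<lambda>x. (\<Prod>b\<in>Basis. (x \<bullet> b) ^ \<alpha> b) *\<^sub>R c)"
      by (intro polynomial_function_mult) (simp_all add: real_polynomial_function_eq[symmetric])
    then show ?case by (simp add: monomial_def scaleR_conv_of_real mult.commute)
  qed auto
next
  assume "polynomial_function f"
  \<comment> \<open>\<open>polynomial_function\<close> is defined by testing against bounded linear
    functionals; \<open>Re\<close> and \<open>Im\<close> are two of them and together recover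
    \<open>f\<close>.\<close>
  then have "real_polynomial_function (Re \<circ> f)" "real_polynomial_function (Im \<circ> f)"
    unfolding polynomial_function_def using bounded_linear_Re bounded_linear_Im by auto
  then have "cpoly (\<lambda>x. of_real ((Re \<circ> f) x) + \<i> * of_real ((Im \<circ> f) x))"
    by (intro cpoly_of_real cpoly_intros)
  then show "cpoly f" by (simp add: complex_eq[symmetric])
qed

section \<open>Derivatives and the Laplacian on polynomials\<close>

lemma partial_eq: "(f has_derivative f') (at x) \<Longrightarrow> partial b f x = f' b"
  by (simp add: partial_def frechet_derivative_at[symmetric])

text \<open>The product rule, coordinate by coordinate. For \<open>\<alpha> b = 0\<close> the
  truncated exponent \<open>\<alpha> b - 1\<close> is harmless, since the factor
  \<open>of_nat (\<alpha> b)\<close> vanishes.\<close>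

lemma monomial_has_derivative:
  "(monomial \<alpha> has_derivative (\<lambda>h. \<Sum>b\<in>Basis. of_real (h \<bullet> b) * of_nat (\<alpha> b) * monomial (\<alpha>(b := \<alpha> b - 1)) x))
     (at (x::'a::euclidean_space))"
proof -
  have 1: "monomial \<alpha> = (\<lambda>x. of_real (\<Prod>b\<in>Basis. (x \<bullet> b) ^ \<alpha> b))"
    by (simp add: monomial_def fun_eq_iff)
  have 2: "(\<Prod>c\<in>Basis. (x \<bullet> c) ^ (\<alpha>(b := \<alpha> b - 1)) c)
      = (x \<bullet> b) ^ (\<alpha> b - 1) * (\<Prod>c\<in>Basis - {b}. (x \<bullet> c) ^ \<alpha> c)" if "b \<in> Basis" for b
    using prod.remove[OF finite_Basis that, of "\<lambda>c. (x \<bullet> c) ^ (\<alpha>(b := \<alpha> b - 1)) c"] by simp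
  have 3: "((\<lambda>x. \<Prod>b\<in>Basis. (x \<bullet> b) ^ \<alpha> b) has_derivative
      (\<lambda>h. \<Sum>b\<in>Basis. (of_nat (\<alpha> b) * (h \<bullet> b) * (x \<bullet> b) ^ (\<alpha> b - 1)) * (\<Prod>c\<in>Basis - {b}. (x \<bullet> c) ^ \<alpha> c))) (at x)"
    by (rule has_derivative_prod) (auto intro!: derivative_eq_intros)
  have 4: "(\<Sum>b\<in>Basis. of_real (h \<bullet> b) * of_nat (\<alpha> b) * monomial (\<alpha>(b := \<alpha> b - 1)) x)
      = (of_real (\<Sum>b\<in>Basis. (of_nat (\<alpha> b) * (h \<bullet> b) * (x \<bullet> b) ^ (\<alpha> b - 1)) *
           (\<Prod>c\<in>Basis - {b}. (x \<bullet> c) ^ \<alpha> c)) :: complex)" for h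
    unfolding of_real_sum
    by (intro sum.cong refl) (simp only: 2 monomial_def of_real_mult of_real_of_nat_eq mult_ac)
  show ?thesis
    unfolding 1 4[unfolded 1] by (rule has_derivative_of_real[OF 3])
qed

lemma partial_monomial:
  assumes "b \<in> Basis"
  shows "partial b (monomial \<alpha>) = (\<lambda>x. of_nat (\<alpha> b) * monomial (\<alpha>(b := \<alpha> b - 1)) x)"
proof
  fix x
  have "(\<Sum>c\<in>Basis. of_real (b \<bullet> c) * of_nat (\<alpha> c) * monomial (\<alpha>(c := \<alpha> c - 1)) x)
      = (\<Sum>c\<in>Basis. if c = b then of_nat (\<alpha> b) * monomial (\<alpha>(b := \<alpha> b - 1)) x else 0)"
    using assms by (intro sum.cong) (auto simp: inner_Basis)
  then show "partial b (monomial \<alpha>) x = of_nat (\<alpha> b) * monomial (\<alpha>(b := \<alpha> b - 1)) x"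
    using assms by (simp add: partial_eq[OF monomial_has_derivative])
qed

lemma cpoly_differentiable: "cpoly f \<Longrightarrow> f differentiable (at x)"
proof (induction rule: cpoly.induct)
  case (monom \<alpha> c)
  then show ?case
    using monomial_has_derivative by (intro differentiable_mult) (auto simp: differentiable_def)
qed auto

lemma cpoly_has_derivative: "cpoly f \<Longrightarrow> (f has_derivative (\<lambda>h. partial h f x)) (at x)"
  using cpoly_differentiable unfolding partial_def by (simp add: frechet_derivative_works)

lemma partial_add:
  "cpoly f \<Longrightarrow> cpoly g \<Longrightarrow> partial b (\<lambda>x. f x + g x) = (\<lambda>x. partial b f x + partial b g x)"
  using partial_eq[OF has_derivative_add[OF cpoly_has_derivative cpoly_has_derivative]] by blast

lemma partial_mult:
  "cpoly f \<Longrightarrow> cpoly g \<Longrightarrow> partial b (\<lambda>x. f x * g x) = (\<lambda>x. partial b f x * g x + f x * partial b g x)"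
  by (rule ext) (simp add: partial_eq[OF has_derivative_mult[OF cpoly_has_derivative cpoly_has_derivative]])

lemma partial_const: "partial b (\<lambda>x. c) = (\<lambda>x. 0)"
  by (rule ext) (simp add: partial_eq[OF has_derivative_const])

lemma partial_cmult: "cpoly f \<Longrightarrow> partial b (\<lambda>x. c * f x) = (\<lambda>x. c * partial b f x)"
  by (simp add: partial_mult[OF cpoly_const] partial_const)

lemma cpoly_partial:
  assumes "cpoly f" "b \<in> Basis"
  shows "cpoly (partial b f)"
  using assms(1)
proof (induction rule: cpoly.induct)
  case (monom \<alpha> c)
  then show ?case
    using assms(2)
    by (simp add: partial_cmult cpoly_monomial partial_monomial multi_indices_upd cpoly_cmult)
qed (auto simp: partial_add intro: cpoly.add)

lemma laplacian_add:
  "cpoly f \<Longrightarrow> cpoly g \<Longrightarrow> laplacian (\<lambda>x. f x + g x) = (\<lambda>x. laplacian f x + laplacian g x)"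
  by (simp add: laplacian_def partial_add cpoly_partial sum.distrib)

lemma laplacian_cmult: "cpoly f \<Longrightarrow> laplacian (\<lambda>x. c * f x) = (\<lambda>x. c * laplacian f x)"
  by (simp add: laplacian_def partial_cmult cpoly_partial sum_distrib_left)

lemma laplacian_const: "laplacian (\<lambda>x. c) = (\<lambda>x. 0)"
  by (simp add: laplacian_def partial_const)

lemma laplacian_sum:
  "(\<And>i. i \<in> I \<Longrightarrow> cpoly (f i)) \<Longrightarrow> laplacian (\<lambda>x. \<Sum>i\<in>I. f i x) = (\<lambda>x. \<Sum>i\<in>I. laplacian (f i) x)"
  by (induction I rule: infinite_finite_induct) (auto simp: laplacian_const laplacian_add cpoly_sum)

section \<open>Monomial coefficients and the Fischer inner product\<close>

text \<open>On \<open>nat\<close> a factor \<open>n - l\<close> vanishes as soon as \<open>j > n\<close>, so truncation is harmless.\<close>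

definition falling :: "nat \<Rightarrow> nat \<Rightarrow> nat" where
  "falling n j = (\<Prod>l<j. n - l)"

lemma falling_self: "falling n n = fact n"
  by (simp add: falling_def fact_prod_rev lessThan_atLeast0)

lemma falling_eq_0: "n < j \<Longrightarrow> falling n j = 0"
  by (auto simp: falling_def)

definition mfact :: "('a::euclidean_space \<Rightarrow> nat) \<Rightarrow> nat" where
  "mfact \<alpha> = (\<Prod>b\<in>Basis. fact (\<alpha> b))"

lemma mfact_pos: "mfact \<alpha> > 0"
  by (simp add: mfact_def prod_pos)

lemma mfact_nonzero [simp]: "mfact \<alpha> \<noteq> 0"
  using mfact_pos[of \<alpha>] by simp

section \<open>Iterated derivatives of monomials\<close>

lemma partial_cmult_monomial:
  assumes "b \<in> Basis" "\<alpha> \<in> multi_indices"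
  shows "partial b (\<lambda>x. c * monomial \<alpha> x) = (\<lambda>x. c * of_nat (\<alpha> b) * monomial (\<alpha>(b := \<alpha> b - 1)) x)"
  using assms by (simp add: partial_cmult cpoly_monomial partial_monomial mult.assoc)

lemma funpow_partial_monomial:
  assumes "b \<in> Basis" "\<alpha> \<in> multi_indices"
  shows "(partial b ^^ n) (\<lambda>x. c * monomial \<alpha> x) =
    (\<lambda>x. c * of_nat (falling (\<alpha> b) n) * monomial (\<alpha>(b := \<alpha> b - n)) x)"
proof (induction n)
  case 0
  then show ?case by (simp add: falling_def)
next
  case (Suc n)
  show ?case
    unfolding funpow.simps o_apply Suc.IH
      partial_cmult_monomial[OF assms(1) multi_indices_upd[OF assms(2,1)]]
    by (simp add: falling_def mult.assoc del: fun_upd_apply add: fun_upd_same)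
qed

text \<open>Since the list is distinct, each of its coordinates is lowered by
  \<open>\<beta> b\<close> in one go. Where \<open>\<alpha> b < \<beta> b\<close> the truncated
  exponent does no harm because \<open>falling\<close> is \<open>0\<close> there.\<close>

lemma foldr_partial_monomial:
  assumes "distinct bs" "set bs \<subseteq> Basis" "\<alpha> \<in> multi_indices"
  shows "foldr (\<lambda>b. partial b ^^ \<beta> b) bs (\<lambda>x. c * monomial \<alpha> x) =
    (\<lambda>x. c * of_nat (\<Prod>b\<in>set bs. falling (\<alpha> b) (\<beta> b)) *
       monomial (\<lambda>b. if b \<in> set bs then \<alpha> b - \<beta> b else \<alpha> b) x)"
  using assms
proof (induction bs)
  case Nil
  then show ?case by simp
next
  case (Cons b bs)
  let ?\<gamma> = "\<lambda>b. if b \<in> set bs then \<alpha> b - \<beta> b else \<alpha> b"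
  have "?\<gamma> \<in> multi_indices"
    using Cons.prems by (auto simp: multi_indices_def)
  moreover have "?\<gamma>(b := ?\<gamma> b - \<beta> b) = (\<lambda>c. if c \<in> set (b # bs) then \<alpha> c - \<beta> c else \<alpha> c)"
    using Cons.prems by (auto simp: fun_eq_iff)
  ultimately show ?case
    using Cons funpow_partial_monomial[of b ?\<gamma> "\<beta> b" "c * of_nat (\<Prod>b\<in>set bs. falling (\<alpha> b) (\<beta> b))"]
    by (simp add: mult_ac)
qed

lemma Basis_enumeration:
  "distinct (SOME bs. distinct bs \<and> set bs = (Basis :: 'a::euclidean_space set))"
  "set (SOME bs. distinct bs \<and> set bs = (Basis :: 'a::euclidean_space set)) = Basis"
proof -
  have "\<exists>bs. distinct bs \<and> set bs = (Basis :: 'a set)"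
    using finite_distinct_list[of "Basis :: 'a set"] by auto
  from someI_ex[OF this]
  show "distinct (SOME bs. distinct bs \<and> set bs = (Basis :: 'a set))"
    "set (SOME bs. distinct bs \<and> set bs = (Basis :: 'a set)) = Basis" by auto
qed

lemma monomial_at_0: "monomial \<gamma> 0 = (if \<forall>b\<in>Basis. \<gamma> b = 0 then 1 else 0)"
  by (auto simp: monomial_def)

lemma multi_indices_eqI:
  "\<alpha> \<in> multi_indices \<Longrightarrow> \<beta> \<in> multi_indices \<Longrightarrow> (\<And>b. b \<in> Basis \<Longrightarrow> \<alpha> b = \<beta> b) \<Longrightarrow> \<alpha> = \<beta>"
proof
  fix b
  assume "\<alpha> \<in> multi_indices" "\<beta> \<in> multi_indices" "\<And>b. b \<in> Basis \<Longrightarrow> \<alpha> b = \<beta> b"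
  then show "\<alpha> b = \<beta> b"
    by (cases "b \<in> Basis") (auto simp: multi_indices_def)
qed

text \<open>If the indices differ at \<open>b\<close>, either \<open>\<alpha> b > \<beta> b\<close>
  and a positive power survives, which vanishes at the origin, or
  \<open>\<alpha> b < \<beta> b\<close> and the falling factorial is already zero.\<close>

lemma multi_partial_monomial:
  assumes "\<alpha> \<in> multi_indices" "\<beta> \<in> multi_indices"
  shows "multi_partial \<beta> (\<lambda>x. c * monomial \<alpha> x) 0 = (if \<alpha> = \<beta> then c * of_nat (mfact \<beta>) else 0)"
proof -
  have *: "multi_partial \<beta> (\<lambda>x. c * monomial \<alpha> x) 0 = c * of_nat (\<Prod>b\<in>Basis. falling (\<alpha> b) (\<beta> b)) *
       monomial (\<lambda>b. if b \<in> Basis then \<alpha> b - \<beta> b else \<alpha> b) 0"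
    unfolding multi_partial_def
    by (subst foldr_partial_monomial) (simp_all add: Basis_enumeration assms)
  show ?thesis
  proof (cases "\<alpha> = \<beta>")
    case True
    then show ?thesis unfolding * by (simp add: falling_self mfact_def monomial_at_0)
  next
    case False
    then obtain b where b: "b \<in> Basis" "\<alpha> b \<noteq> \<beta> b"
      using multi_indices_eqI[OF assms] by blast
    then consider "\<alpha> b > \<beta> b" | "falling (\<alpha> b) (\<beta> b) = 0"
      using falling_eq_0 by (metis linorder_neqE_nat)
    then show ?thesis
    proof cases
      case 1
      then show ?thesis using False b unfolding * monomial_at_0 by force
    next
      case 2
      then have "(\<Prod>b\<in>Basis. falling (\<alpha> b) (\<beta> b)) = 0" using b by auto
      then show ?thesis using False unfolding * by simp
    qed
  qed
qed

lemma funpow_partial_linear: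
  assumes "b \<in> Basis" "cpoly f" "cpoly g"
  shows "cpoly ((partial b ^^ n) f)"
    and "(partial b ^^ n) (\<lambda>x. f x + g x) = (\<lambda>x. (partial b ^^ n) f x + (partial b ^^ n) g x)"
proof -
  have *: "cpoly ((partial b ^^ n) h)" if "cpoly h" for h n
    using that assms(1) by (induction n) (auto intro: cpoly_partial)
  then show "cpoly ((partial b ^^ n) f)" using assms by blast
  show "(partial b ^^ n) (\<lambda>x. f x + g x) = (\<lambda>x. (partial b ^^ n) f x + (partial b ^^ n) g x)"
    by (induction n) (simp_all add: partial_add * assms)
qed

lemma multi_partial_add:
  assumes "cpoly f" "cpoly g"
  shows "multi_partial \<beta> (\<lambda>x. f x + g x) = (\<lambda>x. multi_partial \<beta> f x + multi_partial \<beta> g x)"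
proof -
  have cp: "cpoly (foldr (\<lambda>b. partial b ^^ \<beta> b) bs h)" if "set bs \<subseteq> Basis" "cpoly h" for bs h
    using that by (induction bs) (auto intro: funpow_partial_linear)
  have "foldr (\<lambda>b. partial b ^^ \<beta> b) bs (\<lambda>x. f x + g x) =
    (\<lambda>x. foldr (\<lambda>b. partial b ^^ \<beta> b) bs f x + foldr (\<lambda>b. partial b ^^ \<beta> b) bs g x)"
    if "set bs \<subseteq> Basis" for bs
    using that by (induction bs) (auto simp: funpow_partial_linear cp assms)
  then show ?thesis
    by (simp add: multi_partial_def Basis_enumeration)
qed

text \<open>The Taylor coefficient at the origin, an explicit candidate for
  \<open>poly_coeffs\<close>. The value \<open>0\<close> off \<open>multi_indices\<close> matches
  the support condition there.\<close>

definition coef :: "('a::euclidean_space \<Rightarrow> complex) \<Rightarrow> ('a \<Rightarrow> nat) \<Rightarrow> complex" where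
  "coef f \<alpha> = (if \<alpha> \<in> multi_indices then multi_partial \<alpha> f 0 / of_nat (mfact \<alpha>) else 0)"

lemma multi_partial_eq_coef:
  "\<alpha> \<in> multi_indices \<Longrightarrow> multi_partial \<alpha> f 0 = coef f \<alpha> * of_nat (mfact \<alpha>)"
  by (simp add: coef_def)

lemma coef_monomial:
  "\<alpha> \<in> multi_indices \<Longrightarrow> coef (\<lambda>x. c * monomial \<alpha> x) = (\<lambda>\<beta>. if \<beta> = \<alpha> then c else 0)"
  by (rule ext) (auto simp: coef_def multi_partial_monomial)

lemma coef_add: "cpoly f \<Longrightarrow> cpoly g \<Longrightarrow> coef (\<lambda>x. f x + g x) = (\<lambda>\<alpha>. coef f \<alpha> + coef g \<alpha>)"
  by (auto simp: coef_def multi_partial_add add_divide_distrib fun_eq_iff)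

lemma coef_const_0: "coef (\<lambda>x. 0) = (\<lambda>\<alpha>. 0)"
  using coef_monomial[OF multi_indices_zero, of 0] by simp

lemma coef_cmult: "cpoly f \<Longrightarrow> coef (\<lambda>x. c * f x) = (\<lambda>\<alpha>. c * coef f \<alpha>)"
proof (induction rule: cpoly.induct)
  case (monom \<alpha> d)
  then show ?case
    using coef_monomial[of \<alpha> "c * d"] by (auto simp: coef_monomial mult.assoc fun_eq_iff)
qed (simp add: distrib_left coef_add cpoly_cmult)

lemma coef_sum:
  "(\<And>i. i \<in> I \<Longrightarrow> cpoly (f i)) \<Longrightarrow> coef (\<lambda>x. \<Sum>i\<in>I. f i x) = (\<lambda>\<alpha>. \<Sum>i\<in>I. coef (f i) \<alpha>)"
  by (induction I rule: infinite_finite_induct) (auto simp: coef_const_0 coef_add cpoly_sum)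

lemma coef_support: "{\<alpha>. coef f \<alpha> \<noteq> 0} \<subseteq> multi_indices"
  by (auto simp: coef_def)

lemma finite_coef: "cpoly f \<Longrightarrow> finite {\<alpha>. coef f \<alpha> \<noteq> 0}"
proof (induction rule: cpoly.induct)
  case (add f g)
  have "{\<alpha>. coef (\<lambda>x. f x + g x) \<alpha> \<noteq> 0} \<subseteq> {\<alpha>. coef f \<alpha> \<noteq> 0} \<union> {\<alpha>. coef g \<alpha> \<noteq> 0}"
    by (auto simp: coef_add add)
  then show ?case using add.IH finite_subset by blast
qed (simp add: coef_monomial)

lemma coef_expansion:
  assumes "cpoly f" "finite A" "{\<alpha>. coef f \<alpha> \<noteq> 0} \<subseteq> A"
  shows "f x = (\<Sum>\<alpha>\<in>A. coef f \<alpha> * monomial \<alpha> x)"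
proof -
  have "f x = (\<Sum>\<alpha> | coef f \<alpha> \<noteq> 0. coef f \<alpha> * monomial \<alpha> x)"
    using assms(1)
  proof (induction rule: cpoly.induct)
    case (monom \<alpha> c)
    have "(\<Sum>\<beta> | coef (\<lambda>x. c * monomial \<alpha> x) \<beta> \<noteq> 0. coef (\<lambda>x. c * monomial \<alpha> x) \<beta> * monomial \<beta> x)
        = (\<Sum>\<beta>\<in>{\<alpha>}. coef (\<lambda>x. c * monomial \<alpha> x) \<beta> * monomial \<beta> x)"
      using monom by (intro sum.mono_neutral_left) (auto simp: coef_monomial)
    then show ?case by (simp add: coef_monomial monom)
  next
    case (add f g)
    let ?A = "{\<alpha>. coef f \<alpha> \<noteq> 0} \<union> {\<alpha>. coef g \<alpha> \<noteq> 0}"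
    have fin: "finite ?A" using add finite_coef by blast
    have *: "(\<Sum>\<alpha> | coef h \<alpha> \<noteq> 0. coef h \<alpha> * monomial \<alpha> x) = (\<Sum>\<alpha>\<in>?A. coef h \<alpha> * monomial \<alpha> x)"
      if "{\<alpha>. coef h \<alpha> \<noteq> 0} \<subseteq> ?A" for h
      using fin that by (intro sum.mono_neutral_left) auto
    have sub: "{\<alpha>. coef (\<lambda>x. f x + g x) \<alpha> \<noteq> 0} \<subseteq> ?A"
      by (auto simp: coef_add add.hyps)
    show ?case
      unfolding *[OF sub] add.IH *[OF Un_upper1] *[OF Un_upper2]
      by (simp add: coef_add add.hyps distrib_right sum.distrib)
  qed
  also have "\<dots> = (\<Sum>\<alpha>\<in>A. coef f \<alpha> * monomial \<alpha> x)"
    using assms by (intro sum.mono_neutral_left) auto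
  finally show ?thesis .
qed

text \<open>Existence is the Taylor expansion. For uniqueness, \<open>coef\<close> applied termwise
  to any competing finite expansion returns the coefficients of that expansion.\<close>

lemma poly_coeffs_eq:
  assumes "cpoly f"
  shows "poly_coeffs f = coef f"
  unfolding poly_coeffs_def
proof (rule the_equality)
  show "finite {\<alpha>. coef f \<alpha> \<noteq> 0} \<and> {\<alpha>. coef f \<alpha> \<noteq> 0} \<subseteq> multi_indices \<and>
     (\<forall>x. f x = (\<Sum>\<alpha> | coef f \<alpha> \<noteq> 0. coef f \<alpha> * monomial \<alpha> x))"
    by (intro conjI allI finite_coef[OF assms] coef_support
        coef_expansion[OF assms finite_coef[OF assms] order.refl])
next
  fix c
  assume c: "finite {\<alpha>. c \<alpha> \<noteq> 0} \<and> {\<alpha>. c \<alpha> \<noteq> 0} \<subseteq> multi_indices \<and>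
     (\<forall>x. f x = (\<Sum>\<alpha> | c \<alpha> \<noteq> 0. c \<alpha> * monomial \<alpha> x))"
  then have mi: "\<alpha> \<in> multi_indices" if "c \<alpha> \<noteq> 0" for \<alpha>
    using that by auto
  have f: "f = (\<lambda>x. \<Sum>\<alpha> | c \<alpha> \<noteq> 0. c \<alpha> * monomial \<alpha> x)"
    by (intro ext) (rule c[THEN conjunct2, THEN conjunct2, rule_format])
  have "coef (\<lambda>x. \<Sum>\<alpha> | c \<alpha> \<noteq> 0. c \<alpha> * monomial \<alpha> x) =
      (\<lambda>\<beta>. \<Sum>\<alpha> | c \<alpha> \<noteq> 0. coef (\<lambda>x. c \<alpha> * monomial \<alpha> x) \<beta>)"
    by (rule coef_sum) (simp add: cpoly.monom mi)
  also have "\<dots> = (\<lambda>\<beta>. \<Sum>\<alpha> | c \<alpha> \<noteq> 0. if \<beta> = \<alpha> then c \<alpha> else 0)"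
    by (intro ext sum.cong refl) (simp add: coef_monomial mi)
  also have "\<dots> = c"
    using c[THEN conjunct1] by (intro ext) simp
  finally show "c = coef f"
    by (subst f) (rule sym)
qed

text \<open>Monomials are orthogonal with squared norm \<open>mfact \<alpha>\<close>. Leaving
  \<open>A\<close> free lets products of several polynomials be summed over the union of their
  supports.\<close>

lemma fischer_inner_eq:
  assumes "cpoly f" "finite A" "{\<alpha>. coef f \<alpha> \<noteq> 0} \<subseteq> A"
  shows "fischer_inner f g = (\<Sum>\<alpha>\<in>A. cnj (coef f \<alpha>) * coef g \<alpha> * of_nat (mfact \<alpha>))"
proof -
  have "fischer_inner f g = (\<Sum>\<alpha> | coef f \<alpha> \<noteq> 0. cnj (coef f \<alpha>) * coef g \<alpha> * of_nat (mfact \<alpha>))"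
    unfolding fischer_inner_def poly_coeffs_eq[OF assms(1)]
    by (rule sum.cong) (auto simp: multi_partial_eq_coef subsetD[OF coef_support])
  also have "\<dots> = (\<Sum>\<alpha>\<in>A. cnj (coef f \<alpha>) * coef g \<alpha> * of_nat (mfact \<alpha>))"
    using assms by (intro sum.mono_neutral_left) auto
  finally show ?thesis .
qed

section \<open>Sesquilinearity and definiteness of the Fischer product\<close>

lemma fischer_inner_commute:
  assumes "cpoly f" "cpoly g"
  shows "fischer_inner g f = cnj (fischer_inner f g)"
proof -
  let ?A = "{\<alpha>. coef f \<alpha> \<noteq> 0} \<union> {\<alpha>. coef g \<alpha> \<noteq> 0}"
  have "finite ?A" using assms finite_coef by blast
  then show ?thesis
    using assms by (simp add: fischer_inner_eq[where A = ?A] mult.commute[of "cnj _"])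
qed

lemma fischer_inner_add_left:
  assumes "cpoly f" "cpoly g"
  shows "fischer_inner (\<lambda>x. f x + g x) h = fischer_inner f h + fischer_inner g h"
proof -
  let ?A = "{\<alpha>. coef f \<alpha> \<noteq> 0} \<union> {\<alpha>. coef g \<alpha> \<noteq> 0}"
  have "finite ?A" using assms finite_coef by blast
  note * = fischer_inner_eq[OF _ this]
  show ?thesis
    using assms by (subst (1 2 3) *) (auto simp: cpoly.add coef_add distrib_right sum.distrib)
qed

lemma fischer_inner_cmult_left:
  assumes "cpoly f"
  shows "fischer_inner (\<lambda>x. c * f x) h = cnj c * fischer_inner f h"
proof -
  note * = fischer_inner_eq[OF _ finite_coef[OF assms]]
  show ?thesis
    using assms by (subst (1 2) *) (auto simp: cpoly_cmult coef_cmult sum_distrib_left mult.assoc)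
qed

lemma fischer_inner_add_right:
  "cpoly f \<Longrightarrow> cpoly g \<Longrightarrow> cpoly h \<Longrightarrow>
     fischer_inner h (\<lambda>x. f x + g x) = fischer_inner h f + fischer_inner h g"
  by (simp add: fischer_inner_eq[OF _ finite_coef order.refl] coef_add
      distrib_left distrib_right sum.distrib)

lemma fischer_inner_cmult_right:
  "cpoly f \<Longrightarrow> cpoly h \<Longrightarrow> fischer_inner h (\<lambda>x. c * f x) = c * fischer_inner h f"
  by (simp add: fischer_inner_eq[OF _ finite_coef order.refl] coef_cmult sum_distrib_left mult_ac)

lemma fischer_inner_zero_left [simp]: "fischer_inner (\<lambda>x. 0) h = 0"
  using fischer_inner_cmult_left[OF cpoly_const, of 0 0 h] by simp

lemma fischer_inner_zero_right [simp]: "cpoly h \<Longrightarrow> fischer_inner h (\<lambda>x. 0) = 0"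
  using fischer_inner_cmult_right[OF cpoly_const, of h 0 0] by simp

lemma fischer_inner_sum_left:
  "(\<And>i. i \<in> I \<Longrightarrow> cpoly (f i)) \<Longrightarrow> fischer_inner (\<lambda>x. \<Sum>i\<in>I. f i x) h = (\<Sum>i\<in>I. fischer_inner (f i) h)"
  by (induction I rule: infinite_finite_induct) (auto simp: fischer_inner_add_left cpoly_sum)

lemma fischer_inner_sum_right:
  "(\<And>i. i \<in> I \<Longrightarrow> cpoly (f i)) \<Longrightarrow> cpoly h \<Longrightarrow>
     fischer_inner h (\<lambda>x. \<Sum>i\<in>I. f i x) = (\<Sum>i\<in>I. fischer_inner h (f i))"
  by (induction I rule: infinite_finite_induct) (auto simp: fischer_inner_add_right cpoly_sum)

lemma fischer_inner_monomial:
  assumes "\<alpha> \<in> multi_indices" "\<beta> \<in> multi_indices"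
  shows "fischer_inner (\<lambda>x. c * monomial \<alpha> x) (\<lambda>x. d * monomial \<beta> x) =
    (if \<alpha> = \<beta> then cnj c * d * of_nat (mfact \<alpha>) else 0)"
  using assms by (subst fischer_inner_eq[where A = "{\<alpha>}"]) (auto simp: coef_monomial cpoly.monom)

text \<open>With equal arguments the product is a sum of squared moduli with positive weights
  \<open>mfact \<alpha>\<close>, so every coefficient must vanish.\<close>

lemma fischer_inner_self_eq_0:
  assumes "cpoly f" "fischer_inner f f = 0"
  shows "f = (\<lambda>x. 0)"
proof -
  let ?A = "{\<alpha>. coef f \<alpha> \<noteq> 0}"
  have fin: "finite ?A" by (rule finite_coef[OF assms(1)])
  have "fischer_inner f f = of_real (\<Sum>\<alpha>\<in>?A. (norm (coef f \<alpha>))\<^sup>2 * real (mfact \<alpha>))"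
    unfolding fischer_inner_eq[OF assms(1) fin order.refl] of_real_sum of_real_mult complex_norm_square
    by (simp add: mult.commute)
  then have "(\<Sum>\<alpha>\<in>?A. (norm (coef f \<alpha>))\<^sup>2 * real (mfact \<alpha>)) = 0"
    using assms(2) by (metis of_real_eq_0_iff)
  then have "\<forall>\<alpha>\<in>?A. (norm (coef f \<alpha>))\<^sup>2 * real (mfact \<alpha>) = 0"
    using fin by (subst (asm) sum_nonneg_eq_0_iff) auto
  then have "?A = {}" by auto
  then show ?thesis
    using coef_expansion[OF assms(1) fin order.refl] by auto
qed

section \<open>Multiplication as the adjoint of differentiation\<close>

lemma monomial_upd_Suc:
  "b \<in> Basis \<Longrightarrow> monomial (\<alpha>(b := Suc (\<alpha> b))) x = of_real (x \<bullet> b) * monomial \<alpha> x"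
proof -
  assume "b \<in> Basis"
  have "\<alpha>(b := Suc (\<alpha> b)) = (\<lambda>c. (if c = b then 1 else 0) + \<alpha> c)" by auto
  then show ?thesis
    using monomial_add[of "\<lambda>c. if c = b then 1 else 0" \<alpha> x] monomial_unit[OF \<open>b \<in> Basis\<close>, of x] by simp
qed

lemma mfact_upd_Suc: "b \<in> Basis \<Longrightarrow> mfact (\<alpha>(b := Suc (\<alpha> b))) = Suc (\<alpha> b) * mfact \<alpha>"
proof -
  assume b: "b \<in> Basis"
  have "(\<Prod>c\<in>Basis - {b}. fact ((\<alpha>(b := Suc (\<alpha> b))) c)) = (\<Prod>c\<in>Basis - {b}. fact (\<alpha> c) :: nat)"
    by (rule prod.cong) auto
  then show ?thesis
    unfolding mfact_def prod.remove[OF finite_Basis b] by (simp add: algebra_simps)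
qed

text \<open>On monomials both sides vanish unless \<open>\<beta>\<close> is \<open>\<alpha>\<close>
  raised by one at \<open>b\<close>; then the derivative contributes
  \<open>\<beta> b = Suc (\<alpha> b)\<close>, exactly the ratio of \<open>mfact \<beta>\<close> to
  \<open>mfact \<alpha>\<close>.\<close>

lemma fischer_inner_coordinate:
  assumes b: "b \<in> Basis" and f: "cpoly f" and g: "cpoly g"
  shows "fischer_inner (\<lambda>x. of_real (x \<bullet> b) * f x) g = fischer_inner f (partial b g)"
  using f
proof (induction rule: cpoly.induct)
  case (monom \<alpha> c)
  have 1: "(\<lambda>x. of_real (x \<bullet> b) * (c * monomial \<alpha> x)) = (\<lambda>x. c * monomial (\<alpha>(b := Suc (\<alpha> b))) x)"
    by (simp add: monomial_upd_Suc[OF b] mult.left_commute)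
  from g show ?case
  proof (induction rule: cpoly.induct)
    case (monom \<beta> d)
    show ?case
    proof (cases "\<alpha>(b := Suc (\<alpha> b)) = \<beta>")
      case True
      then have "\<beta> b = Suc (\<alpha> b)" "\<beta>(b := \<beta> b - 1) = \<alpha>" "mfact \<beta> = Suc (\<alpha> b) * mfact \<alpha>"
        using mfact_upd_Suc[OF b, of \<alpha>] by auto
      then show ?thesis
        unfolding 1 True using b \<open>\<alpha> \<in> multi_indices\<close> monom
        by (simp add: partial_cmult_monomial fischer_inner_monomial distrib_right)
    next
      case False
      \<comment> \<open>Either the derivative of the second monomial is zero or its lowered exponent
        differs from \<open>\<alpha>\<close>.\<close>
      have "\<beta> b = 0 \<or> \<alpha> \<noteq> \<beta>(b := \<beta> b - 1)"
        using False by (cases "\<beta> b") auto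
      then show ?thesis
        unfolding 1 using False b \<open>\<alpha> \<in> multi_indices\<close> monom
        by (auto simp: partial_cmult_monomial fischer_inner_monomial multi_indices_upd cpoly.monom)
    qed
  next
    case (add g h)
    then show ?case
      using \<open>\<alpha> \<in> multi_indices\<close> b
      by (simp add: partial_add fischer_inner_add_right cpoly_partial cpoly.monom cpoly_mult cpoly_coordinate)
  qed
next
  case (add f h)
  then show ?case
    using b by (simp add: distrib_left fischer_inner_add_left cpoly_mult cpoly_coordinate)
qed

text \<open>Each square \<open>(x \<bullet> b)^2\<close> moves across as two derivatives in
  direction \<open>b\<close>; summing over the basis gives the Laplacian.\<close>

lemma fischer_inner_norm_sq:
  assumes "cpoly f" "cpoly g"
  shows "fischer_inner (\<lambda>x. of_real (norm x ^ 2) * f x) g = fischer_inner f (laplacian g)"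
proof -
  have cp: "cpoly (\<lambda>x. of_real (x \<bullet> b) * h x)" if "b \<in> Basis" "cpoly h" for b h
    using that by (intro cpoly_mult cpoly_coordinate)
  have "fischer_inner (\<lambda>x. of_real (norm x ^ 2) * f x) g =
      (\<Sum>b\<in>Basis. fischer_inner (\<lambda>x. of_real (x \<bullet> b) * (of_real (x \<bullet> b) * f x)) g)"
    unfolding norm_sq_eq_sum unfolding sum_distrib_right power2_eq_square mult.assoc
    using assms by (intro fischer_inner_sum_left cp)
  also have "\<dots> = (\<Sum>b\<in>Basis. fischer_inner f (partial b (partial b g)))"
    using assms by (intro sum.cong refl) (auto simp: fischer_inner_coordinate cp cpoly_partial)
  also have "\<dots> = fischer_inner f (laplacian g)"
    unfolding laplacian_def using assms by (intro fischer_inner_sum_right[symmetric] cpoly_partial)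
  finally show ?thesis .
qed

section \<open>Uniqueness of the Fischer decomposition\<close>

lemma harmonic_polys_iff: "f \<in> harmonic_polys \<longleftrightarrow> cpoly f \<and> laplacian f = (\<lambda>x. 0)"
  by (simp add: harmonic_polys_def cpoly_iff fun_eq_iff)

lemma harmonic_polys_zero: "(\<lambda>x. 0) \<in> harmonic_polys"
  by (simp add: harmonic_polys_iff cpoly_const laplacian_const)

lemma harmonic_polys_add:
  "f \<in> harmonic_polys \<Longrightarrow> g \<in> harmonic_polys \<Longrightarrow> (\<lambda>x. f x + g x) \<in> harmonic_polys"
  by (simp add: harmonic_polys_iff cpoly.add laplacian_add)

lemma harmonic_polys_cmult: "f \<in> harmonic_polys \<Longrightarrow> (\<lambda>x. c * f x) \<in> harmonic_polys"
  by (simp add: harmonic_polys_iff cpoly_cmult laplacian_cmult)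

text \<open>Away from the origin one can divide by \<open>|x|^2\<close>; the origin itself follows
  by continuity.\<close>

lemma norm_sq_mult_eq_0:
  fixes g :: "'a::euclidean_space \<Rightarrow> complex"
  assumes "cpoly g" "\<And>x. of_real (norm x ^ 2) * g x = 0"
  shows "g x = 0"
proof -
  have g: "g x = 0" if "x \<noteq> 0" for x
    using assms(2)[of x] that by simp
  have "(g \<longlongrightarrow> g 0) (at 0)"
    using differentiable_imp_continuous_within[OF cpoly_differentiable[OF assms(1)]]
    by (simp add: continuous_within)
  moreover have "(g \<longlongrightarrow> 0) (at 0)"
    by (rule Lim_transform_eventually[OF tendsto_const]) (simp add: eventually_at_filter g)
  ultimately have "g 0 = 0"
    using tendsto_unique at_neq_bot by blast
  then show ?thesis using g by (cases "x = 0") auto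
qed

text \<open>Multiplication by \<open>|x|\<^sup>2\<close> is the Fischer adjoint of the Laplacian, so \<open>h\<close> is orthogonal to \<open>|x|\<^sup>2 w\<close>.\<close>

lemma harmonic_plus_norm_sq_eq_0:
  assumes h: "h \<in> harmonic_polys" and w: "cpoly w"
    and eq: "\<And>x. h x + of_real (norm x ^ 2) * w x = 0"
  shows "h = (\<lambda>x. 0)" "w = (\<lambda>x. 0)"
proof -
  have h': "cpoly h" "laplacian h = (\<lambda>x. 0)" using h by (auto simp: harmonic_polys_iff)
  have "h = (\<lambda>x. (- 1) * (of_real (norm x ^ 2) * w x))"
    using eq by (auto simp: fun_eq_iff add_eq_0_iff)
  then have "fischer_inner h h = fischer_inner (\<lambda>x. (- 1) * (of_real (norm x ^ 2) * w x)) h"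
    by (rule arg_cong)
  also have "\<dots> = - fischer_inner w (laplacian h)"
    by (simp only: fischer_inner_cmult_left[OF cpoly_mult[OF cpoly_norm_sq w]] fischer_inner_norm_sq[OF w h'(1)]) simp
  also have "\<dots> = 0" using w h' by simp
  finally show h0: "h = (\<lambda>x. 0)" by (rule fischer_inner_self_eq_0[OF h'(1)])
  show "w = (\<lambda>x. 0)"
    using norm_sq_mult_eq_0[OF w] eq unfolding h0 by (intro ext) simp
qed

section \<open>Finite sums of radial multiples of harmonic polynomials\<close>

lemma cpoly_radial_sum:
  assumes "\<And>s. s \<le> n \<Longrightarrow> H s \<in> harmonic_polys"
  shows "cpoly (\<lambda>x. \<Sum>s\<le>n. of_real (norm x ^ (2 * s)) * H s x)"
  using assms by (intro cpoly_sum cpoly_mult cpoly_norm) (simp add: harmonic_polys_iff)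

lemma radial_sum_Suc:
  "(\<Sum>s\<le>Suc n. of_real (norm x ^ (2 * s)) * H s x) =
    H 0 x + of_real (norm x ^ 2) * (\<Sum>s\<le>n. of_real (norm x ^ (2 * s)) * H (Suc s) x :: complex)"
  by (simp add: sum.atMost_Suc_shift sum_distrib_left power2_eq_square mult_ac del: sum.atMost_Suc)

text \<open>The \<open>s = 0\<close> term is harmonic and the rest is \<open>|x|^2\<close> times a
  shorter sum, so both vanish by \<open>harmonic_plus_norm_sq_eq_0\<close>, and the induction
  continues with the shifted sequence.\<close>

lemma radial_sum_eq_0:
  assumes "\<And>s. s \<le> n \<Longrightarrow> H s \<in> harmonic_polys"
    and "\<And>x. (\<Sum>s\<le>n. of_real (norm x ^ (2 * s)) * H s x) = 0"
    and "s \<le> n"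
  shows "H s = (\<lambda>x. 0)"
  using assms
proof (induction n arbitrary: H s)
  case 0
  then show ?case by (auto simp: fun_eq_iff)
next
  case (Suc n)
  let ?w = "\<lambda>x. \<Sum>s\<le>n. of_real (norm x ^ (2 * s)) * H (Suc s) x"
  have "H 0 \<in> harmonic_polys" "cpoly ?w"
    using Suc.prems(1) cpoly_radial_sum[of n "\<lambda>s. H (Suc s)"] by auto
  moreover have "H 0 x + of_real (norm x ^ 2) * ?w x = 0" for x
    using Suc.prems(2)[of x] unfolding radial_sum_Suc .
  ultimately have 0: "H 0 = (\<lambda>x. 0)" and w: "?w = (\<lambda>x. 0)"
    by (rule harmonic_plus_norm_sq_eq_0)+
  have "H (Suc t) = (\<lambda>x. 0)" if "t \<le> n" for t
    using Suc.IH[of "\<lambda>s. H (Suc s)" t] Suc.prems(1) fun_cong[OF w] that by simp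
  then show ?case using 0 Suc.prems(3) by (cases s) auto
qed

lemma fischer_decomposition_unique:
  assumes "fischer_decomposition f H" "fischer_decomposition f H'"
  shows "H = H'"
proof
  fix s
  let ?S = "{s. H s \<noteq> (\<lambda>x. 0)}" and ?S' = "{s. H' s \<noteq> (\<lambda>x. 0)}"
  have fin: "finite ?S" "finite ?S'" and har: "\<And>s. H s \<in> harmonic_polys" "\<And>s. H' s \<in> harmonic_polys"
    using assms by (auto simp: fischer_decomposition_def)
  \<comment> \<open>One bound for both supports, and for \<open>s\<close> itself, puts the two
    expansions over the same range.\<close>
  obtain n where n: "?S \<union> ?S' \<union> {s} \<subseteq> {..n}"
    using fin finite_nat_set_iff_bounded_le[of "?S \<union> ?S' \<union> {s}"] by (auto simp: subset_iff)
  let ?D = "\<lambda>s x. H s x + (- 1) * H' s x"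
  have "f x = (\<Sum>s\<le>n. of_real (norm x ^ (2 * s)) * H s x)"
       "f x = (\<Sum>s\<le>n. of_real (norm x ^ (2 * s)) * H' s x)" for x
  proof -
    have "f x = (\<Sum>s\<in>?S. of_real (norm x ^ (2 * s)) * H s x)"
      using assms(1) by (auto simp: fischer_decomposition_def)
    also have "\<dots> = (\<Sum>s\<le>n. of_real (norm x ^ (2 * s)) * H s x)"
      using n by (intro sum.mono_neutral_left) auto
    finally show "f x = (\<Sum>s\<le>n. of_real (norm x ^ (2 * s)) * H s x)" .
    have "f x = (\<Sum>s\<in>?S'. of_real (norm x ^ (2 * s)) * H' s x)"
      using assms(2) by (auto simp: fischer_decomposition_def)
    also have "\<dots> = (\<Sum>s\<le>n. of_real (norm x ^ (2 * s)) * H' s x)"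
      using n by (intro sum.mono_neutral_left) auto
    finally show "f x = (\<Sum>s\<le>n. of_real (norm x ^ (2 * s)) * H' s x)" .
  qed
  then have "(\<Sum>s\<le>n. of_real (norm x ^ (2 * s)) * ?D s x) = 0" for x
    by (simp add: right_diff_distrib sum_subtractf)
  moreover have "?D s \<in> harmonic_polys" for s
    by (intro harmonic_polys_add harmonic_polys_cmult har)
  ultimately have "?D s = (\<lambda>x. 0)"
    using n by (intro radial_sum_eq_0[of n ?D]) auto
  then show "H s = H' s" by (simp add: fun_eq_iff)
qed

text \<open>Horner form \<open>h_0 + |x|^2 (h_1 + |x|^2 (...))\<close> of a Fischer decomposition.
  Membership in this class supplies existence of the decomposition for the functions at
  hand.\<close>

inductive fischer_sum :: "('a::euclidean_space \<Rightarrow> complex) \<Rightarrow> bool" where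
  zero: "fischer_sum (\<lambda>x. 0)"
| step: "h \<in> harmonic_polys \<Longrightarrow> fischer_sum w \<Longrightarrow> fischer_sum (\<lambda>x. h x + of_real (norm x ^ 2) * w x)"

lemma cpoly_fischer_sum: "fischer_sum f \<Longrightarrow> cpoly f"
  by (induction rule: fischer_sum.induct)
    (simp_all only: cpoly_const cpoly.add cpoly_mult cpoly_norm_sq harmonic_polys_iff)

lemma fischer_sum_add: "fischer_sum f \<Longrightarrow> fischer_sum g \<Longrightarrow> fischer_sum (\<lambda>x. f x + g x)"
proof (induction f arbitrary: g rule: fischer_sum.induct)
  case (step h w)
  from step.prems show ?case
  proof cases
    case zero
    then show ?thesis using fischer_sum.step[OF step.hyps] by simp
  next
    case (step h' w')
    have "fischer_sum (\<lambda>x. (h x + h' x) + of_real (norm x ^ 2) * (w x + w' x))"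
      using step \<open>h \<in> harmonic_polys\<close>
      by (intro fischer_sum.step harmonic_polys_add \<open>\<And>g. fischer_sum g \<Longrightarrow> fischer_sum (\<lambda>x. w x + g x)\<close>)
    then show ?thesis using step by (simp add: algebra_simps)
  qed
qed simp

lemma fischer_sum_cmult: "fischer_sum f \<Longrightarrow> fischer_sum (\<lambda>x. c * f x)"
proof (induction rule: fischer_sum.induct)
  case (step h w)
  have "fischer_sum (\<lambda>x. c * h x + of_real (norm x ^ 2) * (c * w x))"
    using step by (intro fischer_sum.step harmonic_polys_cmult)
  then show ?case by (simp add: algebra_simps)
qed (simp add: fischer_sum.zero)

lemma fischer_sum_sum:
  "(\<And>i. i \<in> I \<Longrightarrow> fischer_sum (f i)) \<Longrightarrow> fischer_sum (\<lambda>x. \<Sum>i\<in>I. f i x)"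
  by (induction I rule: infinite_finite_induct) (auto intro: fischer_sum_add fischer_sum.zero)

text \<open>The Horner form is multiplied out. Each step shifts the harmonic factors by one index,
  hence the witness \<open>case_nat h H\<close>.\<close>

lemma fischer_sum_expansion:
  "fischer_sum f \<Longrightarrow> \<exists>n H. (\<forall>s. H s \<in> harmonic_polys) \<and> (\<forall>s>n. H s = (\<lambda>x. 0)) \<and>
     (\<forall>x. f x = (\<Sum>s\<le>n. of_real (norm x ^ (2 * s)) * H s x))"
proof (induction rule: fischer_sum.induct)
  case zero
  show ?case by (rule exI[of _ 0], rule exI[of _ "\<lambda>s x. 0"]) (simp add: harmonic_polys_zero)
next
  case (step h w)
  then obtain n H where H: "\<And>s. H s \<in> harmonic_polys" "\<And>s. s > n \<Longrightarrow> H s = (\<lambda>x. 0)"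
    "\<And>x. w x = (\<Sum>s\<le>n. of_real (norm x ^ (2 * s)) * H s x)" by blast
  let ?H = "case_nat h H"
  have "?H s \<in> harmonic_polys" for s using step H by (cases s) auto
  moreover have "?H s = (\<lambda>x. 0)" if "s > Suc n" for s using H(2) that by (cases s) auto
  moreover have "h x + of_real (norm x ^ 2) * w x = (\<Sum>s\<le>Suc n. of_real (norm x ^ (2 * s)) * ?H s x)" for x
    unfolding radial_sum_Suc by (simp add: H(3))
  ultimately show ?case by blast
qed

text \<open>This evaluates the definite description: \<open>h\<close> followed by the factors of
  \<open>w\<close> is a decomposition, by uniqueness the only one, and its entry at \<open>0\<close>
  is \<open>h\<close>.\<close>

lemma harmonic_proj_eqI:
  assumes "h \<in> harmonic_polys" "fischer_sum w"
  shows "harmonic_proj (\<lambda>x. h x + of_real (norm x ^ 2) * w x) = h"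
proof -
  let ?f = "\<lambda>x. h x + of_real (norm x ^ 2) * w x"
  obtain n H where H: "\<And>s. H s \<in> harmonic_polys" "\<And>s. s > n \<Longrightarrow> H s = (\<lambda>x. 0)"
    "\<And>x. w x = (\<Sum>s\<le>n. of_real (norm x ^ (2 * s)) * H s x)"
    using fischer_sum_expansion[OF assms(2)] by blast
  let ?H = "case_nat h H"
  have har: "?H s \<in> harmonic_polys" for s using assms(1) H by (cases s) auto
  have sup: "{s. ?H s \<noteq> (\<lambda>x. 0)} \<subseteq> {..Suc n}"
  proof
    fix s assume "s \<in> {s. ?H s \<noteq> (\<lambda>x. 0)}"
    then show "s \<in> {..Suc n}" using H(2)[of "s - 1"] by (cases s) (auto simp: not_less)
  qed
  have "?f x = (\<Sum>s | ?H s \<noteq> (\<lambda>x. 0). of_real (norm x ^ (2 * s)) * ?H s x)" for x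
  proof -
    have "?f x = (\<Sum>s\<le>Suc n. of_real (norm x ^ (2 * s)) * ?H s x)"
      unfolding radial_sum_Suc by (simp add: H(3))
    also have "\<dots> = (\<Sum>s | ?H s \<noteq> (\<lambda>x. 0). of_real (norm x ^ (2 * s)) * ?H s x)"
      using sup by (intro sum.mono_neutral_right) auto
    finally show ?thesis .
  qed
  then have dec: "fischer_decomposition ?f ?H"
    using har finite_subset[OF sup] by (simp add: fischer_decomposition_def)
  then have "(THE H. fischer_decomposition ?f H) = ?H"
    using fischer_decomposition_unique[OF _ dec] by (rule the_equality)
  then show ?thesis by (simp add: harmonic_proj_def)
qed

section \<open>Radial multiples and products of polynomials\<close>

definition radial :: "nat \<Rightarrow> ('a::euclidean_space \<Rightarrow> complex) \<Rightarrow> 'a \<Rightarrow> complex" where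
  "radial a f x = of_real (norm x ^ (2 * a)) * f x"

lemma radial_0 [simp]: "radial 0 f = f"
  by (simp add: radial_def fun_eq_iff)

lemma radial_Suc: "radial (Suc a) f x = of_real (norm x ^ 2) * radial a f x"
  by (simp add: radial_def power2_eq_square mult_ac)

lemma cpoly_radial: "cpoly f \<Longrightarrow> cpoly (radial a f)"
  unfolding radial_def[abs_def] by (intro cpoly_mult cpoly_norm)

lemma homogeneous_radial: "homogeneous k f \<Longrightarrow> homogeneous (2 * a + k) (radial a f)"
  by (simp add: homogeneous_def radial_def power_add power_mult power_mult_distrib)

text \<open>Differentiate \<open>f (t *\<^sub>R x)\<close> in \<open>t\<close> at \<open>1\<close>
  twice over: by the chain rule, and as \<open>t ^ k\<close> times the constant
  \<open>f x\<close>.\<close>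

lemma euler_homogeneous:
  assumes f: "cpoly f" and hom: "homogeneous k f"
  shows "(\<Sum>b\<in>Basis. of_real (x \<bullet> b) * partial b f x) = of_nat k * f x"
proof -
  let ?f' = "\<lambda>h. partial h f x"
  have f': "(f has_derivative ?f') (at x)" by (rule cpoly_has_derivative[OF f])
  interpret f': bounded_linear ?f' by (rule has_derivative_bounded_linear[OF f'])
  have "((\<lambda>t. f (t *\<^sub>R x)) has_vector_derivative ?f' x) (at 1)"
  proof -
    have "((\<lambda>t::real. t *\<^sub>R x) has_derivative (\<lambda>t. t *\<^sub>R x)) (at 1)"
      by (auto intro!: derivative_eq_intros)
    moreover have "(f has_derivative ?f') (at (1 *\<^sub>R x))" using f' by simp
    ultimately have "((\<lambda>t. f (t *\<^sub>R x)) has_derivative (\<lambda>t. ?f' (t *\<^sub>R x))) (at 1)"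
      by (rule has_derivative_compose)
    then show ?thesis by (simp add: has_vector_derivative_def f'.scaleR)
  qed
  moreover have "((\<lambda>t. f (t *\<^sub>R x)) has_vector_derivative of_nat k * f x) (at 1)"
  proof -
    have "((\<lambda>t::real. (t ^ k) *\<^sub>R f x) has_vector_derivative (of_nat k) *\<^sub>R f x) (at 1)"
      by (auto intro!: derivative_eq_intros simp: has_vector_derivative_def fun_eq_iff)
    then show ?thesis
      using hom by (simp add: homogeneous_def scaleR_conv_of_real)
  qed
  ultimately have "?f' x = of_nat k * f x"
    by (rule vector_derivative_unique_at)
  moreover have "?f' x = ?f' (\<Sum>b\<in>Basis. (x \<bullet> b) *\<^sub>R b)"
    by (simp add: euclidean_representation)
  moreover have "\<dots> = (\<Sum>b\<in>Basis. of_real (x \<bullet> b) * partial b f x)"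
    by (simp only: f'.sum f'.scaleR scaleR_conv_of_real)
  ultimately show ?thesis by simp
qed

lemma partial_norm_sq: "partial b (\<lambda>x. of_real (norm x ^ 2)) = (\<lambda>x::'a::euclidean_space. 2 * of_real (x \<bullet> b))"
proof
  fix x :: 'a
  have "((\<lambda>x. of_real (x \<bullet> x) :: complex) has_derivative (\<lambda>h. of_real (x \<bullet> h + h \<bullet> x))) (at x)"
    by (intro has_derivative_of_real has_derivative_inner has_derivative_ident)
  then show "partial b (\<lambda>x. of_real (norm x ^ 2)) x = 2 * of_real (x \<bullet> b)"
    unfolding power2_norm_eq_inner by (subst partial_eq) (auto simp: inner_commute)
qed

lemma partial_coordinate: "b \<in> Basis \<Longrightarrow> partial b (\<lambda>x. of_real (x \<bullet> b)) = (\<lambda>x. 1)"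
  by (rule ext, subst partial_eq[OF has_derivative_of_real[OF has_derivative_inner_left[OF has_derivative_ident]]])
    (simp add: inner_Basis)

text \<open>Leibniz rule: \<open>|x|^2\<close> has gradient \<open>2 x\<close> and Laplacian twice
  the dimension. The middle term is the Euler operator, a scalar on homogeneous polynomials.\<close>

lemma laplacian_norm_sq_mult:
  fixes f :: "'a::euclidean_space \<Rightarrow> complex"
  assumes f: "cpoly f"
  shows "laplacian (\<lambda>x. of_real (norm x ^ 2) * f x) x =
    2 * of_nat (DIM('a)) * f x + 4 * (\<Sum>b\<in>Basis. of_real (x \<bullet> b) * partial b f x) +
    of_real (norm x ^ 2) * laplacian f x"
proof -
  have "partial b (partial b (\<lambda>x. of_real (norm x ^ 2) * f x)) x =
    2 * f x + 4 * (of_real (x \<bullet> b) * partial b f x) + of_real (norm x ^ 2) * partial b (partial b f) x"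
    if b: "b \<in> Basis" for b
  proof -
    note cp = cpoly_norm_sq cpoly_partial[OF f b] f cpoly_coordinate[OF b]
    have "partial b (\<lambda>x. of_real (norm x ^ 2) * f x) =
      (\<lambda>x. 2 * (of_real (x \<bullet> b) * f x) + of_real (norm x ^ 2) * partial b f x)"
      unfolding partial_mult[OF cpoly_norm_sq f] partial_norm_sq by (simp add: mult.assoc)
    then have "partial b (partial b (\<lambda>x. of_real (norm x ^ 2) * f x)) =
      partial b (\<lambda>x. 2 * (of_real (x \<bullet> b) * f x) + of_real (norm x ^ 2) * partial b f x)"
      by (rule arg_cong)
    also have "\<dots> = (\<lambda>x. 2 * (f x + of_real (x \<bullet> b) * partial b f x) +
       (2 * of_real (x \<bullet> b) * partial b f x + of_real (norm x ^ 2) * partial b (partial b f) x))"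
      by (subst partial_add)
        (simp_all only: cp cpoly_mult cpoly_cmult partial_cmult partial_mult partial_norm_sq
          partial_coordinate[OF b] mult_1_left)
    finally show ?thesis by (simp add: algebra_simps)
  qed
  then show ?thesis
    by (simp add: laplacian_def sum.distrib sum_distrib_left)
qed

text \<open>One more factor \<open>|x|^2\<close> on a polynomial of degree \<open>2 a + k\<close>
  adds \<open>2 d + 4 (2 a + k)\<close> to the coefficient, \<open>d\<close> being the dimension. At
  \<open>a = 0\<close> the index \<open>a - 1\<close> is immaterial because the coefficient is
  zero.\<close>

lemma laplacian_radial:
  fixes P :: "'a::euclidean_space \<Rightarrow> complex"
  assumes "P \<in> harmonic_polys_deg k"
  shows "laplacian (radial a P) x =
    of_real (4 * real a * (real a + real k + real (DIM('a)) / 2 - 1)) * radial (a - 1) P x"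
proof -
  have P: "cpoly P" "laplacian P = (\<lambda>x. 0)" "homogeneous k P"
    using assms by (auto simp: harmonic_polys_deg_def harmonic_polys_iff)
  show ?thesis
  proof (induction a)
    case 0
    then show ?case by (simp add: P)
  next
    case (Suc a)
    \<comment> \<open>For positive \<open>a\<close> the factor \<open>|x|^2\<close> turns
      \<open>radial (a - 1) P\<close> back into \<open>radial a P\<close>; for \<open>a = 0\<close>
      both sides are zero.\<close>
    have IH: "of_real (norm x ^ 2) * laplacian (radial a P) x =
        of_real (4 * real a * (real a + real k + real (DIM('a)) / 2 - 1)) * radial a P x"
      unfolding Suc.IH by (cases a) (simp_all add: radial_Suc mult_ac)
    have "laplacian (radial (Suc a) P) x = laplacian (\<lambda>x. of_real (norm x ^ 2) * radial a P x) x"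
      by (simp only: radial_Suc[abs_def])
    also have "\<dots> = 2 * of_nat (DIM('a)) * radial a P x + 4 * (of_nat (2 * a + k) * radial a P x) +
       of_real (4 * real a * (real a + real k + real (DIM('a)) / 2 - 1)) * radial a P x"
      unfolding laplacian_norm_sq_mult[OF cpoly_radial[OF P(1)]] IH
        euler_homogeneous[OF cpoly_radial[OF P(1)] homogeneous_radial[OF P(3)]] ..
    also have "\<dots> = of_real (4 * real (Suc a) * (real (Suc a) + real k + real (DIM('a)) / 2 - 1)) * radial a P x"
      by (simp add: algebra_simps)
    finally show ?case by simp
  qed
qed

section \<open>Tensor products on a product space\<close>

definition tensor :: "('a \<Rightarrow> complex) \<Rightarrow> ('b \<Rightarrow> complex) \<Rightarrow> 'a \<times> 'b \<Rightarrow> complex" where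
  "tensor f g z = f (fst z) * g (snd z)"

lemma cpoly_fst: "cpoly f \<Longrightarrow> cpoly (\<lambda>z::'a::euclidean_space \<times> 'b::euclidean_space. f (fst z))"
  using polynomial_function_compose[OF polynomial_function_bounded_linear[OF bounded_linear_fst], of f]
  by (simp add: cpoly_iff o_def)

lemma cpoly_snd: "cpoly f \<Longrightarrow> cpoly (\<lambda>z::'a::euclidean_space \<times> 'b::euclidean_space. f (snd z))"
  using polynomial_function_compose[OF polynomial_function_bounded_linear[OF bounded_linear_snd], of f]
  by (simp add: cpoly_iff o_def)

lemma cpoly_tensor: "cpoly f \<Longrightarrow> cpoly g \<Longrightarrow> cpoly (tensor f g)"
  unfolding tensor_def[abs_def] by (intro cpoly_mult cpoly_fst cpoly_snd)

lemma partial_0: "cpoly f \<Longrightarrow> partial 0 f = (\<lambda>x. 0)"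
  by (rule ext) (rule linear_0[OF has_derivative_linear[OF cpoly_has_derivative]])

lemma partial_fst:
  assumes "cpoly f"
  shows "partial h (\<lambda>z::'a::euclidean_space \<times> 'b::euclidean_space. f (fst z)) = (\<lambda>z. partial (fst h) f (fst z))"
  by (rule ext, rule partial_eq, rule has_derivative_compose[OF has_derivative_fst[OF has_derivative_ident]
        cpoly_has_derivative[OF assms]])

lemma partial_snd:
  assumes "cpoly f"
  shows "partial h (\<lambda>z::'a::euclidean_space \<times> 'b::euclidean_space. f (snd z)) = (\<lambda>z. partial (snd h) f (snd z))"
  by (rule ext, rule partial_eq, rule has_derivative_compose[OF has_derivative_snd[OF has_derivative_ident]
        cpoly_has_derivative[OF assms]])

lemma partial_tensor:
  assumes "cpoly f" "cpoly g"
  shows "partial (b, 0) (tensor f g) = tensor (partial b f) g"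
    and "partial (0, c) (tensor f g) = tensor f (partial c g)"
  unfolding tensor_def[abs_def] partial_mult[OF cpoly_fst[OF assms(1)] cpoly_snd[OF assms(2)]]
    partial_fst[OF assms(1)] partial_snd[OF assms(2)]
  by (simp_all add: partial_0 assms)

lemma sum_Basis_prod:
  fixes f :: "'a::euclidean_space \<times> 'b::euclidean_space \<Rightarrow> 'c::comm_monoid_add"
  shows "(\<Sum>z\<in>Basis. f z) = (\<Sum>b\<in>Basis. f (b, 0)) + (\<Sum>c\<in>Basis. f (0, c))"
proof -
  have "inj_on (\<lambda>u. (u::'a, 0::'b)) Basis" "inj_on (\<lambda>u. (0::'a, u::'b)) Basis"
    by (auto intro!: inj_onI)
  then show ?thesis
    unfolding Basis_prod_def
    by (subst sum.union_disjoint) (auto simp: Basis_prod_def sum.reindex)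
qed

lemma laplacian_tensor:
  assumes "cpoly f" "cpoly g"
  shows "laplacian (tensor f g) = (\<lambda>z. tensor (laplacian f) g z + tensor f (laplacian g) z)"
  by (simp add: laplacian_def sum_Basis_prod partial_tensor cpoly_partial assms fun_eq_iff
      tensor_def sum_distrib_left sum_distrib_right)

text \<open>Exponents on the product space, read off at the basis vectors \<open>(b, 0)\<close> and
  \<open>(0, c)\<close>. The value \<open>0\<close> off both axes helps to keep the result in
  \<open>multi_indices\<close>; at the origin it is \<open>\<alpha> 0\<close>, which is
  \<open>0\<close> for a multi-index.\<close>

definition join :: "('a::euclidean_space \<Rightarrow> nat) \<Rightarrow> ('b::euclidean_space \<Rightarrow> nat) \<Rightarrow> 'a \<times> 'b \<Rightarrow> nat" where
  "join \<alpha> \<beta> z = (if snd z = 0 then \<alpha> (fst z) else if fst z = 0 then \<beta> (snd z) else 0)"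

lemma join_multi_indices: "\<alpha> \<in> multi_indices \<Longrightarrow> \<beta> \<in> multi_indices \<Longrightarrow> join \<alpha> \<beta> \<in> multi_indices"
  by (auto simp: multi_indices_def join_def Basis_prod_def image_iff)

lemma join_apply:
  "join \<alpha> \<beta> (b, 0) = \<alpha> b" "c \<noteq> 0 \<Longrightarrow> join \<alpha> \<beta> (0, c) = \<beta> c"
  by (auto simp: join_def)

lemma join_inject:
  assumes "\<alpha> \<in> multi_indices" "\<beta> \<in> multi_indices" "\<alpha>' \<in> multi_indices" "\<beta>' \<in> multi_indices"
  shows "join \<alpha> \<beta> = join \<alpha>' \<beta>' \<longleftrightarrow> \<alpha> = \<alpha>' \<and> \<beta> = \<beta>'"
proof
  assume eq: "join \<alpha> \<beta> = join \<alpha>' \<beta>'"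
  have "\<alpha> b = \<alpha>' b" for b
    using fun_cong[OF eq, of "(b, 0)"] by (simp add: join_apply)
  moreover have "\<beta> c = \<beta>' c" if "c \<in> Basis" for c
    using fun_cong[OF eq, of "(0, c)"] nonzero_Basis[OF that] by (simp add: join_apply)
  ultimately show "\<alpha> = \<alpha>' \<and> \<beta> = \<beta>'"
    using assms by (auto intro: multi_indices_eqI)
qed simp

lemma prod_Basis_prod:
  fixes f :: "'a::euclidean_space \<times> 'b::euclidean_space \<Rightarrow> 'c::comm_monoid_mult"
  shows "(\<Prod>z\<in>Basis. f z) = (\<Prod>b\<in>Basis. f (b, 0)) * (\<Prod>c\<in>Basis. f (0, c))"
proof -
  have "inj_on (\<lambda>u. (u::'a, 0::'b)) Basis" "inj_on (\<lambda>u. (0::'a, u::'b)) Basis"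
    by (auto intro!: inj_onI)
  then show ?thesis
    unfolding Basis_prod_def
    by (subst prod.union_disjoint) (auto simp: Basis_prod_def prod.reindex)
qed

lemma monomial_join: "monomial (join \<alpha> \<beta>) z = monomial \<alpha> (fst z) * monomial \<beta> (snd z)"
  by (cases z) (simp add: monomial_def prod_Basis_prod join_apply nonzero_Basis)

lemma mfact_join: "mfact (join \<alpha> \<beta>) = mfact \<alpha> * mfact \<beta>"
  by (simp add: mfact_def prod_Basis_prod join_apply nonzero_Basis)

lemma tensor_add:
  "tensor (\<lambda>x. f x + f' x) g = (\<lambda>z. tensor f g z + tensor f' g z)"
  "tensor f (\<lambda>x. g x + g' x) = (\<lambda>z. tensor f g z + tensor f g' z)"
  by (simp_all add: tensor_def fun_eq_iff distrib_left distrib_right)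

lemma tensor_monomial:
  "tensor (\<lambda>x. c * monomial \<alpha> x) (\<lambda>x. d * monomial \<beta> x) = (\<lambda>z. c * d * monomial (join \<alpha> \<beta>) z)"
  by (simp add: tensor_def fun_eq_iff monomial_join mult_ac)

text \<open>Both sides are additive in all four arguments, so nested inductions leave monomials;
  there \<open>join\<close> is injective and \<open>mfact\<close> multiplicative.\<close>

lemma fischer_inner_tensor:
  assumes "cpoly f" "cpoly g" "cpoly f'" "cpoly g'"
  shows "fischer_inner (tensor f g) (tensor f' g') = fischer_inner f f' * fischer_inner g g'"
  using assms(1)
proof (induction rule: cpoly.induct)
  case f: (monom \<alpha> c)
  from assms(2) show ?case
  proof (induction rule: cpoly.induct)
    case g: (monom \<beta> d)
    from assms(3) show ?case
    proof (induction rule: cpoly.induct)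
      case f': (monom \<alpha>' c')
      from assms(4) show ?case
      proof (induction rule: cpoly.induct)
        case g': (monom \<beta>' d')
        show ?case
          unfolding tensor_monomial using f g f' g'
          by (simp add: fischer_inner_monomial join_multi_indices join_inject mfact_join)
      next
        case (add g' g'')
        then show ?case
          using cpoly.monom[OF f, of c] cpoly.monom[OF g, of d] cpoly.monom[OF f', of c']
          by (simp add: tensor_add fischer_inner_add_right cpoly_tensor distrib_left)
      qed
    next
      case (add f' f'')
      then show ?case
        using cpoly.monom[OF f, of c] cpoly.monom[OF g, of d] assms
        by (simp add: tensor_add fischer_inner_add_right cpoly_tensor distrib_right)
    qed
  next
    case (add g h)
    then show ?case
      using cpoly.monom[OF f, of c] assms
      by (simp add: tensor_add fischer_inner_add_left fischer_inner_add_right cpoly_tensor distrib_left)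
  qed
next
  case (add f h)
  then show ?case
    using assms by (simp add: tensor_add fischer_inner_add_left cpoly_tensor distrib_right)
qed

section \<open>Jacobi coefficients\<close>

text \<open>The coefficient of \<open>R^(s - j) S^j\<close> in the homogenised Jacobi polynomial, by
  \<open>jacobi_homogeneous\<close>.\<close>

definition jacobi_coeff :: "real \<Rightarrow> real \<Rightarrow> nat \<Rightarrow> nat \<Rightarrow> real" where
  "jacobi_coeff a b s j = ((a + real s) gchoose j) * ((b + real s) gchoose (s - j)) * (- 1) ^ (s - j)"

lemma gbinomial_Suc_mult: "(real j + 1) * (a gchoose Suc j) = (a - real j) * (a gchoose j)"
  using gbinomial_absorption[of j a] gbinomial_absorb_comp[of a j] by (simp add: add.commute)

text \<open>Up to a factor \<open>4\<close> this is the coefficient of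
  \<open>R^(n - j) S^j P Q\<close> in the Laplacian of \<open>J(R, S) P Q\<close> for
  \<open>s = Suc n\<close>. The ratios of consecutive binomials turn the two terms into the same
  product with opposite signs.\<close>

lemma jacobi_coeff_Suc:
  assumes "j \<le> n"
  shows "jacobi_coeff a b (Suc n) j * ((real (Suc n - j)) * (real (Suc n - j) + a)) +
    jacobi_coeff a b (Suc n) (Suc j) * (real (Suc j) * (real (Suc j) + b)) = 0"
proof -
  \<comment> \<open>Writing \<open>n = j + t\<close> removes truncated subtraction from the
    binomials.\<close>
  define t where "t = n - j"
  have n: "n = j + t" "Suc n - j = Suc t" using assms by (auto simp: t_def)
  define A where "A = (a + real (Suc n) gchoose j)"
  define A' where "A' = (a + real (Suc n) gchoose Suc j)"
  define B where "B = (b + real (Suc n) gchoose t)"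
  define B' where "B' = (b + real (Suc n) gchoose Suc t)"
  have rec: "(real j + 1) * A' = (a + real t + 1) * A" "(real t + 1) * B' = (b + real j + 1) * B"
    using gbinomial_Suc_mult[of j "a + real (Suc n)"] gbinomial_Suc_mult[of t "b + real (Suc n)"]
    by (simp_all add: A_def A'_def B_def B'_def n algebra_simps)
  have coeff: "jacobi_coeff a b (Suc n) j = A * B' * (- 1) * (- 1) ^ t"
      "jacobi_coeff a b (Suc n) (Suc j) = A' * B * (- 1) ^ t"
    by (simp_all add: jacobi_coeff_def A_def A'_def B_def B'_def n)
  have "jacobi_coeff a b (Suc n) j * ((real (Suc n - j)) * (real (Suc n - j) + a)) +
    jacobi_coeff a b (Suc n) (Suc j) * (real (Suc j) * (real (Suc j) + b)) =
    (- 1) ^ t * (B * (real j + 1 + b) * ((real j + 1) * A') - A * (real t + 1 + a) * ((real t + 1) * B'))"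
    unfolding coeff by (simp add: n(2) algebra_simps)
  also have "\<dots> = (- 1) ^ t * (B * (real j + 1 + b) * ((a + real t + 1) * A) - A * (real t + 1 + a) * ((b + real j + 1) * B))"
    unfolding rec ..
  also have "\<dots> = 0" by (simp add: algebra_simps)
  finally show ?thesis .
qed

text \<open>This is \<open>J(1, -1)\<close>. The signs \<open>(-1)^(s - j)\<close> and
  \<open>(-1)^j\<close> combine to the constant \<open>(-1)^s\<close>, leaving a Vandermonde
  convolution.\<close>

lemma sum_jacobi_coeff:
  "(\<Sum>j\<le>s. jacobi_coeff a b s j * (- 1) ^ j) = (- 1) ^ s * ((a + b + 2 * real s) gchoose s)"
proof -
  have "jacobi_coeff a b s j * (- 1) ^ j = (- 1) ^ s * (((a + real s) gchoose j) * ((b + real s) gchoose (s - j)))"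
    if "j \<le> s" for j
    using that power_add[of "- 1 :: real" "s - j" j] by (simp add: jacobi_coeff_def mult_ac)
  then have "(\<Sum>j\<le>s. jacobi_coeff a b s j * (- 1) ^ j) =
      (- 1) ^ s * (\<Sum>j\<in>{0..s}. ((a + real s) gchoose j) * ((b + real s) gchoose (s - j)))"
    by (simp add: sum_distrib_left atLeast0AtMost)
  then show ?thesis
    unfolding gbinomial_Vandermonde by (simp add: algebra_simps)
qed

lemma jacobi_homogeneous:
  fixes R S :: real
  assumes "R \<ge> 0" "S \<ge> 0"
  shows "(R + S) ^ s * jacobi s a b ((S - R) / (S + R)) = (\<Sum>j\<le>s. jacobi_coeff a b s j * R ^ (s - j) * S ^ j)"
proof (cases "R + S = 0")
  case True
  \<comment> \<open>Here the quotient takes the default value \<open>0\<close>. For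
    \<open>s = 0\<close> both sides are \<open>1\<close>; otherwise \<open>(R + S)^s\<close> and
    every summand vanish.\<close>
  then have RS: "R = 0" "S = 0" using assms by auto
  show ?thesis
  proof (cases s)
    case 0
    then show ?thesis by (simp add: jacobi_def jacobi_coeff_def)
  next
    case (Suc n)
    have "jacobi_coeff a b s j * R ^ (s - j) * S ^ j = 0" if "j \<le> s" for j
      using Suc by (cases j) (auto simp: RS)
    then show ?thesis using Suc by (simp add: RS)
  qed
next
  case False
  define t where "t = (S - R) / (S + R)"
  have t: "t + 1 = 2 * (S / (R + S))" "t - 1 = 2 * (- R / (R + S))"
    using False by (simp_all add: t_def field_simps)
  have "(R + S) ^ s * (1 / 2 ^ s * (A * B * (t + 1) ^ j * (t - 1) ^ (s - j))) = A * B * (- 1) ^ (s - j) * R ^ (s - j) * S ^ j"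
    if "j \<le> s" for j A B
  proof -
    have s: "(R + S) ^ s = (R + S) ^ j * (R + S) ^ (s - j)" "(2::real) ^ s = 2 ^ j * 2 ^ (s - j)"
      using that by (simp_all flip: power_add)
    have m: "(- R) ^ (s - j) = (- 1) ^ (s - j) * R ^ (s - j)"
      by (rule power_minus)
    show ?thesis
      unfolding t s power_mult_distrib power_divide m using False by (simp add: field_simps)
  qed
  then show ?thesis
    unfolding jacobi_def t_def[symmetric] jacobi_coeff_def sum_distrib_left by (intro sum.cong) auto
qed

section \<open>Harmonic projection of a product\<close>

locale harmonic_pair =
  fixes P :: "'a::euclidean_space \<Rightarrow> complex" and Q :: "'b::euclidean_space \<Rightarrow> complex" and k i :: nat
  assumes P: "P \<in> harmonic_polys_deg k" and Q: "Q \<in> harmonic_polys_deg i"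
begin

definition \<alpha> :: real where "\<alpha> = real k + (real (DIM('a)) - 2) / 2"

definition \<beta> :: real where "\<beta> = real i + (real (DIM('b)) - 2) / 2"

definition radial_tensor :: "nat \<Rightarrow> nat \<Rightarrow> 'a \<times> 'b \<Rightarrow> complex" where
  "radial_tensor a b = tensor (radial a P) (radial b Q)"

definition jacobi_poly :: "nat \<Rightarrow> 'a \<times> 'b \<Rightarrow> complex" where
  "jacobi_poly s z = (\<Sum>j\<le>s. of_real (jacobi_coeff \<alpha> \<beta> s j) * radial_tensor (s - j) j z)"

text \<open>The value \<open>J(1, -1)\<close> from \<open>sum_jacobi_coeff\<close>; its inverse will
  be \<open>proj_factor\<close>.\<close>

definition reduction_coeff :: "nat \<Rightarrow> real" where
  "reduction_coeff s = (- 1) ^ s * ((\<alpha> + \<beta> + 2 * real s) gchoose s)"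

lemma cpoly_PQ: "cpoly P" "cpoly Q" and laplacian_PQ: "laplacian P = (\<lambda>x. 0)" "laplacian Q = (\<lambda>x. 0)"
  using P Q by (auto simp: harmonic_polys_deg_def harmonic_polys_iff)

lemma cpoly_radial_tensor: "cpoly (radial_tensor a b)"
  unfolding radial_tensor_def by (intro cpoly_tensor cpoly_radial cpoly_PQ)

lemma cpoly_jacobi_poly: "cpoly (jacobi_poly s)"
  unfolding jacobi_poly_def[abs_def] by (intro cpoly_sum cpoly_cmult cpoly_radial_tensor)

lemma laplacian_radial_tensor:
  "laplacian (radial_tensor a b) z = of_real (4 * (real a * (real a + \<alpha>))) * radial_tensor (a - 1) b z +
     of_real (4 * (real b * (real b + \<beta>))) * radial_tensor a (b - 1) z"
proof -
  have "laplacian (radial a P) x = of_real (4 * (real a * (real a + \<alpha>))) * radial (a - 1) P x" for x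
  proof -
    have "4 * real a * (real a + real k + real DIM('a) / 2 - 1) = 4 * (real a * (real a + \<alpha>))"
      by (simp add: \<alpha>_def diff_divide_distrib add_ac)
    then show ?thesis unfolding laplacian_radial[OF P] by (simp only:)
  qed
  moreover have "laplacian (radial b Q) y = of_real (4 * (real b * (real b + \<beta>))) * radial (b - 1) Q y" for y
  proof -
    have "4 * real b * (real b + real i + real DIM('b) / 2 - 1) = 4 * (real b * (real b + \<beta>))"
      by (simp add: \<beta>_def diff_divide_distrib add_ac)
    then show ?thesis unfolding laplacian_radial[OF Q] by (simp only:)
  qed
  ultimately show ?thesis
    by (simp add: radial_tensor_def laplacian_tensor cpoly_radial cpoly_PQ tensor_def del: of_real_mult of_real_add)
qed

lemma norm_sq_mult_radial_tensor: "of_real (norm z ^ 2) * radial_tensor a b z = radial_tensor (Suc a) b z + radial_tensor a (Suc b) z"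
  by (cases z) (simp add: radial_tensor_def tensor_def radial_Suc norm_prod_def algebra_simps)

text \<open>The term \<open>j\<close> differentiated in \<open>u\<close> and the term
  \<open>j + 1\<close> differentiated in \<open>v\<close> are multiples of the same
  \<open>radial_tensor\<close>, and they cancel by \<open>jacobi_coeff_Suc\<close>.\<close>

lemma jacobi_poly_harmonic: "jacobi_poly s \<in> harmonic_polys"
proof -
  let ?c = "jacobi_coeff \<alpha> \<beta> s"
  have "laplacian (jacobi_poly s) z = 0" for z
  proof -
    have "laplacian (jacobi_poly s) z = (\<Sum>j\<le>s. of_real (?c j) * laplacian (radial_tensor (s - j) j) z)"
      unfolding jacobi_poly_def[abs_def]
      by (simp add: laplacian_sum cpoly_cmult cpoly_radial_tensor laplacian_cmult)
    also have "\<dots> = (\<Sum>j\<le>s. of_real (4 * (?c j * (real (s - j) * (real (s - j) + \<alpha>)))) * radial_tensor (s - j - 1) j z) +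
        (\<Sum>j\<le>s. of_real (4 * (?c j * (real j * (real j + \<beta>)))) * radial_tensor (s - j) (j - 1) z)"
      unfolding laplacian_radial_tensor by (simp add: sum.distrib[symmetric] algebra_simps)
    also have "\<dots> = 0"
    proof (cases s)
      case 0
      then show ?thesis by simp
    next
      case (Suc n)
      \<comment> \<open>A zero factor removes the term \<open>j = s\<close> from the first sum and
        the term \<open>j = 0\<close> from the second; an index shift then aligns the two.\<close>
      have "(\<Sum>j\<le>s. of_real (4 * (?c j * (real (s - j) * (real (s - j) + \<alpha>)))) * radial_tensor (s - j - 1) j z) =
        (\<Sum>j\<le>n. of_real (4 * (?c j * (real (Suc n - j) * (real (Suc n - j) + \<alpha>)))) * radial_tensor (n - j) j z)"
        using Suc by simp
      moreover have "(\<Sum>j\<le>s. of_real (4 * (?c j * (real j * (real j + \<beta>)))) * radial_tensor (s - j) (j - 1) z) =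
        (\<Sum>j\<le>n. of_real (4 * (?c (Suc j) * (real (Suc j) * (real (Suc j) + \<beta>)))) * radial_tensor (n - j) j z)"
        using Suc by (simp add: sum.atMost_Suc_shift del: sum.atMost_Suc)
      moreover have "of_real (4 * (?c j * (real (Suc n - j) * (real (Suc n - j) + \<alpha>)))) * radial_tensor (n - j) j z +
          of_real (4 * (?c (Suc j) * (real (Suc j) * (real (Suc j) + \<beta>)))) * radial_tensor (n - j) j z = 0" if "j \<le> n" for j
        using jacobi_coeff_Suc[OF that, of \<alpha> \<beta>]
        unfolding Suc distrib_right[symmetric] of_real_add[symmetric] distrib_left[symmetric] by simp
      ultimately show ?thesis by (simp only: sum.distrib[symmetric]) (intro sum.neutral, blast)
    qed
    finally show ?thesis .
  qed
  then show ?thesis by (auto simp: harmonic_polys_iff cpoly_jacobi_poly)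
qed

section \<open>Nonvanishing of the reduction coefficient\<close>

lemma gbinomial_eq_pochhammer: "(\<alpha> + \<beta> + 2 * real s) gchoose s = pochhammer (\<alpha> + \<beta> + real s + 1) s / fact s"
  by (simp add: gbinomial_pochhammer' algebra_simps)

text \<open>Dimensions at least \<open>1\<close> force \<open>\<alpha>\<close> and
  \<open>\<beta>\<close> to be at least \<open>- 1 / 2\<close>, so for \<open>s > 0\<close> the base
  is positive; for \<open>s = 0\<close> the symbol is \<open>1\<close>.\<close>

lemma pochhammer_factor_nonzero: "pochhammer (\<alpha> + \<beta> + real s + 1) s \<noteq> 0"
proof (cases s)
  case (Suc n)
  have "real DIM('a) \<ge> 1" "real DIM('b) \<ge> 1"
    using DIM_positive[where 'a = 'a] DIM_positive[where 'a = 'b] by (simp_all add: Suc_le_eq)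
  moreover have "real k \<ge> 0" "real i \<ge> 0" by simp_all
  ultimately have "\<alpha> \<ge> - 1 / 2" and "\<beta> \<ge> - 1 / 2"
    unfolding \<alpha>_def \<beta>_def by argo+
  then have "\<alpha> + \<beta> + real s + 1 > 0" using Suc by simp
  then show ?thesis using pochhammer_pos by (metis less_irrefl)
qed simp

lemma reduction_coeff_nonzero: "reduction_coeff s \<noteq> 0"
  using pochhammer_factor_nonzero[of s] by (simp add: reduction_coeff_def gbinomial_eq_pochhammer)

text \<open>Modulo \<open>|x|\<^sup>2 = |u|\<^sup>2 + |v|\<^sup>2\<close> one may replace \<open>|v|\<^sup>2\<close> by \<open>- |u|\<^sup>2\<close>; the
  coefficient of \<open>(|u|\<^sup>2)\<^sup>n P Q\<close> obtained from \<open>jacobi_poly n\<close> is \<open>reduction_coeff n\<close> by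
  Vandermonde's identity.\<close>

lemma radial_tensor_congruence:
  assumes IH: "\<And>a b. a + b < n \<Longrightarrow> fischer_sum (radial_tensor a b)" and "j \<le> n"
  shows "\<exists>w. fischer_sum w \<and> (\<forall>z. radial_tensor (n - j) j z = (- 1) ^ j * radial_tensor n 0 z + of_real (norm z ^ 2) * w z)"
  using assms(2)
proof (induction j)
  case 0
  show ?case by (rule exI[of _ "\<lambda>z. 0"]) (simp add: fischer_sum.zero)
next
  case (Suc j)
  then obtain w where w: "fischer_sum w"
    "\<And>z. radial_tensor (n - j) j z = (- 1) ^ j * radial_tensor n 0 z + of_real (norm z ^ 2) * w z" by auto
  \<comment> \<open>By \<open>|x|^2 R^(n-j-1) S^j = R^(n-j) S^j + R^(n-j-1) S^(j+1)\<close>,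
    exchanging one \<open>R\<close> for \<open>S\<close> flips the sign and leaves a remainder of
    total exponent \<open>n - 1\<close>, to which \<open>IH\<close> applies.\<close>
  let ?w = "\<lambda>z. radial_tensor (n - Suc j) j z + (- 1) * w z"
  have "fischer_sum ?w"
    using Suc.prems by (intro fischer_sum_add fischer_sum_cmult w IH) auto
  moreover have "radial_tensor (n - Suc j) (Suc j) z = (- 1) ^ Suc j * radial_tensor n 0 z + of_real (norm z ^ 2) * ?w z" for z
  proof -
    have "Suc (n - Suc j) = n - j" using Suc.prems by auto
    then have "of_real (norm z ^ 2) * radial_tensor (n - Suc j) j z = radial_tensor (n - j) j z + radial_tensor (n - Suc j) (Suc j) z"
      using norm_sq_mult_radial_tensor[of z "n - Suc j" j] by simp
    then show ?thesis unfolding w(2) by (simp add: algebra_simps)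
  qed
  ultimately show ?case by blast
qed

text \<open>Inserting the congruences for all \<open>j\<close> into \<open>jacobi_poly n\<close>
  gives \<open>reduction_coeff n\<close> times \<open>R^n P Q\<close> modulo \<open>|x|^2\<close>,
  and the nonzero coefficient is divided out. The assumption is the induction hypothesis of
  \<open>fischer_sum_radial_tensor\<close>.\<close>

lemma jacobi_poly_congruence:
  assumes IH: "\<And>a b. a + b < n \<Longrightarrow> fischer_sum (radial_tensor a b)"
  shows "\<exists>w. fischer_sum w \<and> (\<forall>z. radial_tensor n 0 z = of_real (inverse (reduction_coeff n)) * jacobi_poly n z + of_real (norm z ^ 2) * w z)"
proof -
  obtain w where w: "\<And>j. j \<le> n \<Longrightarrow> fischer_sum (w j)"
    "\<And>j z. j \<le> n \<Longrightarrow> radial_tensor (n - j) j z = (- 1) ^ j * radial_tensor n 0 z + of_real (norm z ^ 2) * w j z"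
    using radial_tensor_congruence[OF IH] by metis
  let ?c = "jacobi_coeff \<alpha> \<beta> n"
  define W where "W = (\<lambda>z. \<Sum>j\<le>n. of_real (?c j) * w j z)"
  have W: "fischer_sum W"
    unfolding W_def by (intro fischer_sum_sum fischer_sum_cmult w) auto
  have reduction: "jacobi_poly n z = of_real (reduction_coeff n) * radial_tensor n 0 z + of_real (norm z ^ 2) * W z" for z
  proof -
    have "jacobi_poly n z = (\<Sum>j\<le>n. of_real (?c j * (- 1) ^ j) * radial_tensor n 0 z + of_real (norm z ^ 2) * (of_real (?c j) * w j z))"
      unfolding jacobi_poly_def by (intro sum.cong refl) (simp add: w(2) algebra_simps)
    also have "\<dots> = of_real (\<Sum>j\<le>n. ?c j * (- 1) ^ j) * radial_tensor n 0 z + of_real (norm z ^ 2) * W z"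
      by (simp only: sum.distrib W_def sum_distrib_left[symmetric] sum_distrib_right[symmetric] of_real_sum[symmetric])
    finally show ?thesis unfolding sum_jacobi_coeff reduction_coeff_def .
  qed
  have "radial_tensor n 0 z = of_real (inverse (reduction_coeff n)) * jacobi_poly n z + of_real (norm z ^ 2) * (- of_real (inverse (reduction_coeff n)) * W z)" for z
    unfolding reduction using reduction_coeff_nonzero[of n] by (simp add: field_simps)
  then show ?thesis using fischer_sum_cmult[OF W] by blast
qed

lemma jacobi_poly_scaled_harmonic: "(\<lambda>z. of_real (inverse (reduction_coeff n)) * jacobi_poly n z) \<in> harmonic_polys"
  by (rule harmonic_polys_cmult[OF jacobi_poly_harmonic])

text \<open>Strong induction on \<open>a + b\<close>: \<open>jacobi_poly_congruence\<close> handles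
  the pure power of \<open>R\<close>, and \<open>radial_tensor_congruence\<close> reduces mixed
  powers to it.\<close>

lemma fischer_sum_radial_tensor: "fischer_sum (radial_tensor a b)"
proof (induction "a + b" arbitrary: a b rule: less_induct)
  case less
  obtain w where "fischer_sum w"
    "\<And>z. radial_tensor (a + b) 0 z = of_real (inverse (reduction_coeff (a + b))) * jacobi_poly (a + b) z + of_real (norm z ^ 2) * w z"
    using jacobi_poly_congruence[OF less] by blast
  then have "fischer_sum (radial_tensor (a + b) 0)"
    using fischer_sum.step[OF jacobi_poly_scaled_harmonic] by (metis (no_types, lifting) ext)
  moreover obtain w where "fischer_sum w"
    "\<And>z. radial_tensor a b z = (- 1) ^ b * radial_tensor (a + b) 0 z + of_real (norm z ^ 2) * w z"
    using radial_tensor_congruence[OF less, of "a + b" b] by auto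
  \<comment> \<open>With \<open>0\<close> as harmonic part, \<open>|x|^2 w\<close> is again a
    Fischer sum.\<close>
  moreover have "fischer_sum (\<lambda>z. 0 + of_real (norm z ^ 2) * w z)"
    using \<open>fischer_sum w\<close> by (intro fischer_sum.step harmonic_polys_zero)
  ultimately have "fischer_sum (\<lambda>z. (- 1) ^ b * radial_tensor (a + b) 0 z + of_real (norm z ^ 2) * w z)"
    by (intro fischer_sum_add fischer_sum_cmult) simp_all
  then show ?case
    using \<open>\<And>z. radial_tensor a b z = _\<close> by (metis (no_types, lifting) ext)
qed

lemma harmonic_proj_radial_tensor: "harmonic_proj (radial_tensor s 0) = (\<lambda>z. of_real (inverse (reduction_coeff s)) * jacobi_poly s z)"
proof -
  obtain w where w: "fischer_sum w"
    "\<And>z. radial_tensor s 0 z = of_real (inverse (reduction_coeff s)) * jacobi_poly s z + of_real (norm z ^ 2) * w z"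
    using jacobi_poly_congruence[OF fischer_sum_radial_tensor, of s] by blast
  then have "radial_tensor s 0 = (\<lambda>z. of_real (inverse (reduction_coeff s)) * jacobi_poly s z + of_real (norm z ^ 2) * w z)" by blast
  then show ?thesis using harmonic_proj_eqI[OF jacobi_poly_scaled_harmonic w(1)] by simp
qed

section \<open>The Fischer norm of the projection\<close>

lemma radial_inner_self:
  "fischer_inner (radial s P) (radial s P) =
     of_real (4 ^ s * fact s * pochhammer (real k + real (DIM('a)) / 2) s) * fischer_inner P P"
proof (induction s)
  case 0
  then show ?case by simp
next
  case (Suc s)
  \<comment> \<open>The factor gained when one \<open>|u|^2\<close> moves across as a Laplacian;
    these factors multiply up to \<open>4^s s! (k + p/2)_s\<close>.\<close>
  have eq: "4 * real (Suc s) * (real (Suc s) + real k + real (DIM('a)) / 2 - 1) =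
      4 * real (Suc s) * (real k + real (DIM('a)) / 2 + real s)" by simp
  have "fischer_inner (radial (Suc s) P) (radial (Suc s) P) =
      fischer_inner (radial s P) (laplacian (radial (Suc s) P))"
    using fischer_inner_norm_sq[OF cpoly_radial[OF cpoly_PQ(1)] cpoly_radial[OF cpoly_PQ(1)], of s "Suc s"]
    by (simp only: radial_Suc[abs_def])
  also have "laplacian (radial (Suc s) P) =
      (\<lambda>x. of_real (4 * real (Suc s) * (real k + real (DIM('a)) / 2 + real s)) * radial s P x)"
    unfolding laplacian_radial[OF P, THEN ext] eq by simp
  also have "fischer_inner (radial s P) \<dots> =
      of_real (4 * real (Suc s) * (real k + real (DIM('a)) / 2 + real s)) * fischer_inner (radial s P) (radial s P)"
    by (intro fischer_inner_cmult_right cpoly_radial cpoly_PQ)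
  also have "\<dots> = of_real (4 ^ Suc s * fact (Suc s) * pochhammer (real k + real (DIM('a)) / 2) (Suc s)) * fischer_inner P P"
    unfolding Suc.IH pochhammer_Suc mult.assoc[symmetric] of_real_mult[symmetric] fact_Suc power_Suc
    by (simp add: mult_ac)
  finally show ?case .
qed

text \<open>Moving one \<open>|v|^2\<close> across produces the Laplacian of \<open>Q\<close>, which
  is zero; conjugate symmetry then swaps the arguments.\<close>

lemma inner_radial_Suc: "fischer_inner Q (radial (Suc j) Q) = 0"
proof -
  have "fischer_inner (radial (Suc j) Q) Q = fischer_inner (radial j Q) (laplacian Q)"
    using fischer_inner_norm_sq[OF cpoly_radial[OF cpoly_PQ(2)] cpoly_PQ(2), of j]
    by (simp only: radial_Suc[abs_def])
  then show ?thesis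
    using fischer_inner_commute[OF cpoly_radial[OF cpoly_PQ(2)] cpoly_PQ(2), of "Suc j"]
    by (simp add: laplacian_PQ cpoly_radial cpoly_PQ)
qed

text \<open>The product splits over the tensor factors, and for \<open>j > 0\<close> the factor
  pairing \<open>Q\<close> with \<open>|v|^(2 j) Q\<close> is zero.\<close>

lemma radial_tensor_inner_jacobi_poly:
  "fischer_inner (radial_tensor s 0) (jacobi_poly s) =
     of_real (jacobi_coeff \<alpha> \<beta> s 0) * (fischer_inner (radial s P) (radial s P) * fischer_inner Q Q)"
proof -
  have "fischer_inner (radial_tensor s 0) (jacobi_poly s) =
      (\<Sum>j\<le>s. of_real (jacobi_coeff \<alpha> \<beta> s j) * fischer_inner (radial_tensor s 0) (radial_tensor (s - j) j))"
    unfolding jacobi_poly_def[abs_def]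
    by (simp add: fischer_inner_sum_right fischer_inner_cmult_right cpoly_cmult cpoly_radial_tensor)
  also have "\<dots> = (\<Sum>j\<le>s. if j = 0 then of_real (jacobi_coeff \<alpha> \<beta> s 0) * fischer_inner (radial_tensor s 0) (radial_tensor s 0) else 0)"
  proof (intro sum.cong refl)
    fix j
    show "of_real (jacobi_coeff \<alpha> \<beta> s j) * fischer_inner (radial_tensor s 0) (radial_tensor (s - j) j) =
      (if j = 0 then of_real (jacobi_coeff \<alpha> \<beta> s 0) * fischer_inner (radial_tensor s 0) (radial_tensor s 0) else 0)"
      by (cases j) (simp_all add: radial_tensor_def fischer_inner_tensor cpoly_radial cpoly_PQ inner_radial_Suc)
  qed
  also have "\<dots> = of_real (jacobi_coeff \<alpha> \<beta> s 0) * fischer_inner (radial_tensor s 0) (radial_tensor s 0)"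
    by simp
  finally show ?thesis
    by (simp add: radial_tensor_def fischer_inner_tensor cpoly_radial cpoly_PQ)
qed

text \<open>With \<open>R^s P Q = h + |x|^2 w\<close> and \<open>h\<close> harmonic,
  \<open><h, h> = <R^s P Q, h>\<close>. This replaces a double sum over Jacobi coefficients by the
  single term \<open>j = 0\<close>.\<close>

lemma harmonic_proj_norm:
  "fischer_norm_sq (harmonic_proj (radial_tensor s 0)) =
     of_real (inverse (reduction_coeff s) * jacobi_coeff \<alpha> \<beta> s 0) * (fischer_inner (radial s P) (radial s P) * fischer_inner Q Q)"
proof -
  let ?h = "\<lambda>z. of_real (inverse (reduction_coeff s)) * jacobi_poly s z"
  have h: "cpoly ?h" "laplacian ?h = (\<lambda>z. 0)"
    using jacobi_poly_scaled_harmonic by (auto simp: harmonic_polys_iff)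
  obtain w where w: "fischer_sum w" "\<And>z. radial_tensor s 0 z = ?h z + of_real (norm z ^ 2) * w z"
    using jacobi_poly_congruence[OF fischer_sum_radial_tensor, of s] by blast
  have cw: "cpoly w" by (rule cpoly_fischer_sum[OF w(1)])
  have "radial_tensor s 0 = (\<lambda>z. ?h z + of_real (norm z ^ 2) * w z)" using w(2) by blast
  then have "fischer_inner (radial_tensor s 0) ?h = fischer_inner (\<lambda>z. ?h z + of_real (norm z ^ 2) * w z) ?h"
    by (rule arg_cong)
  also have "\<dots> = fischer_inner ?h ?h + fischer_inner w (laplacian ?h)"
    unfolding fischer_inner_add_left[OF h(1) cpoly_mult[OF cpoly_norm_sq cw]]
      fischer_inner_norm_sq[OF cw h(1)] ..
  also have "\<dots> = fischer_norm_sq (harmonic_proj (radial_tensor s 0))"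
    unfolding h(2) harmonic_proj_radial_tensor fischer_norm_sq_def by (simp add: cw)
  finally show ?thesis
    by (simp add: fischer_inner_cmult_right cpoly_jacobi_poly cpoly_radial_tensor radial_tensor_inner_jacobi_poly mult.assoc)
qed

end

theorem theorem5:
  fixes P :: "'a::euclidean_space \<Rightarrow> complex" and Q :: "'b::euclidean_space \<Rightarrow> complex"
    and s k i p q m :: nat
  assumes "p = DIM('a)" and "q = DIM('b)" and "m = p + q"
    and "P \<in> harmonic_polys_deg k" and "Q \<in> harmonic_polys_deg i"
  shows "(\<forall>u v. harmonic_proj (\<lambda>(u, v). of_real (norm u ^ (2 * s)) * P u * Q v) (u, v) =
            of_real (proj_factor m s k i * norm (u, v) ^ (2 * s) *
              jacobi s (real k + (real p - 2) / 2) (real i + (real q - 2) / 2)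
                (((norm v)\<^sup>2 - (norm u)\<^sup>2) / ((norm v)\<^sup>2 + (norm u)\<^sup>2))) * P u * Q v)
         \<and> proj_factor m s k i =
            (- 1) ^ s * fact s / pochhammer (real s + real k + real i + (real m - 2) / 2) s
         \<and> fischer_norm_sq (harmonic_proj (\<lambda>(u, v). of_real (norm u ^ (2 * s)) * P u * Q v)) =
            of_real (norm_factor s k i p q) * fischer_norm_sq P * fischer_norm_sq Q"
proof -
  interpret harmonic_pair P Q k i by unfold_locales fact+
  have ab: "\<alpha> = real k + (real p - 2) / 2" "\<beta> = real i + (real q - 2) / 2"
    by (simp_all add: \<alpha>_def \<beta>_def assms)
  have ab1: "\<alpha> + \<beta> + 2 * real s = 2 * real s + real k + real i + real m / 2 - 2"
    "\<alpha> + \<beta> + real s + 1 = real s + real k + real i + (real m - 2) / 2"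
    by (simp_all add: ab assms(3) field_simps)
  \<comment> \<open>\<open>(- 1)^s\<close> is its own inverse, and
    \<open>\<alpha> + \<beta> + 2 s\<close> is the upper entry of the binomial in
    \<open>proj_factor\<close>.\<close>
  have factor: "proj_factor m s k i = inverse (reduction_coeff s)"
    by (simp add: proj_factor_def reduction_coeff_def ab1 power_inverse[symmetric])
  have input_eq: "(\<lambda>(u, v). of_real (norm u ^ (2 * s)) * P u * Q v) = radial_tensor s 0"
    by (auto simp: radial_tensor_def tensor_def radial_def)
  have jacobi_poly_eq: "jacobi_poly s (u, v) = of_real (norm (u, v) ^ (2 * s) *
      jacobi s \<alpha> \<beta> (((norm v)\<^sup>2 - (norm u)\<^sup>2) / ((norm v)\<^sup>2 + (norm u)\<^sup>2))) * P u * Q v" for u v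
  proof -
    have "norm (u, v) ^ (2 * s) = ((norm u)\<^sup>2 + (norm v)\<^sup>2) ^ s"
      by (simp add: power_mult norm_prod_def)
    \<comment> \<open>The point \<open>u = v = 0\<close>, where the quotient is
      \<open>0 / 0\<close>, is covered because \<open>jacobi_homogeneous\<close> admits
      \<open>R = S = 0\<close>.\<close>
    then have "(\<Sum>j\<le>s. jacobi_coeff \<alpha> \<beta> s j * ((norm u)\<^sup>2) ^ (s - j) * ((norm v)\<^sup>2) ^ j) =
        norm (u, v) ^ (2 * s) * jacobi s \<alpha> \<beta> (((norm v)\<^sup>2 - (norm u)\<^sup>2) / ((norm v)\<^sup>2 + (norm u)\<^sup>2))"
      using jacobi_homogeneous[of "(norm u)\<^sup>2" "(norm v)\<^sup>2" s \<alpha> \<beta>] by simp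
    moreover have "jacobi_poly s (u, v) =
        of_real (\<Sum>j\<le>s. jacobi_coeff \<alpha> \<beta> s j * ((norm u)\<^sup>2) ^ (s - j) * ((norm v)\<^sup>2) ^ j) * P u * Q v"
      unfolding jacobi_poly_def radial_tensor_def tensor_def radial_def fst_conv snd_conv power_mult of_real_sum of_real_mult
        sum_distrib_right
      by (intro sum.cong refl) (simp only: mult_ac)
    ultimately show ?thesis by (simp only:)
  qed
  have 1: "harmonic_proj (radial_tensor s 0) (u, v) = of_real (proj_factor m s k i * norm (u, v) ^ (2 * s) *
      jacobi s \<alpha> \<beta> (((norm v)\<^sup>2 - (norm u)\<^sup>2) / ((norm v)\<^sup>2 + (norm u)\<^sup>2))) * P u * Q v" for u v
    unfolding harmonic_proj_radial_tensor factor jacobi_poly_eq by simp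
  have 2: "proj_factor m s k i = (- 1) ^ s * fact s / pochhammer (real s + real k + real i + (real m - 2) / 2) s"
    unfolding factor reduction_coeff_def gbinomial_eq_pochhammer ab1(2)[symmetric] by (cases "even s") simp_all
  have "inverse (reduction_coeff s) * jacobi_coeff \<alpha> \<beta> s 0 * (4 ^ s * fact s * pochhammer (real k + real (DIM('a)) / 2) s) = norm_factor s k i p q"
  proof -
    \<comment> \<open>Here \<open>\<beta> + 1 = i + q/2\<close> turns the binomial into a Pochhammer
      symbol over \<open>s!\<close>. In the product below, this \<open>s!\<close> and the sign
      cancel against those of the inverse reduction coefficient.\<close>
    have "jacobi_coeff \<alpha> \<beta> s 0 = (- 1) ^ s * (pochhammer (real i + real q / 2) s / fact s)"
      by (simp add: jacobi_coeff_def gbinomial_pochhammer' ab field_simps)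
    then show ?thesis
      unfolding reduction_coeff_def gbinomial_eq_pochhammer norm_factor_def
        assms(1)[symmetric] assms(3)[symmetric] ab1(2)[symmetric]
      using pochhammer_factor_nonzero[of s] by (simp add: field_simps)
  qed
  then have 3: "fischer_norm_sq (harmonic_proj (radial_tensor s 0)) =
      of_real (norm_factor s k i p q) * fischer_norm_sq P * fischer_norm_sq Q"
    unfolding harmonic_proj_norm radial_inner_self unfolding fischer_norm_sq_def
    by (simp only: mult.assoc[symmetric] of_real_mult[symmetric])
  show ?thesis
    unfolding input_eq ab[symmetric] using 1 2 3 by blast
qed

end
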